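(* Let $G:\mathbb{R}^p\to\mathbb{R}^p$ have the finite-sum form $Gx=\frac1n\sum_{i=1}^nG_ix$ with $n\ge1$ and $G_i:\mathbb{R}^p\to\mathbb{R}^p$, let $\mathrm{zer}(G):=\{x:Gx=0\}\ne\emptyset$, and suppose there are $\beta,\bar\beta\in[0,+\infty)$ such that for all $x,y\in\mathbb{R}^p$ $$\langle Gx-Gy,x-y\rangle\ge\beta\|Gx-Gy\|^2+\frac{\bar\beta}{n}\sum_{i=1}^n\|G_ix-G_iy\|^2 .$$ Let $\gamma\in(0,1]$, $s\ge1+3\gamma$, $\Lambda:=1+s-\gamma$ and $\tau\ge1$ be given, and define $$\bar\eta:=\begin{cases}\dfrac{3\bar\beta}{7\Lambda\tau}&\text{if }0<\bar\beta\le\dfrac{7\Lambda\tau\beta}{3(1+\tau)},\\[2ex]\dfrac{\beta}{1+\tau}&\text{if }\bar\beta\ge\dfrac{7\Lambda\tau\beta}{3(1+\tau)}.\end{cases}$$ Let $\{(x^k,y^k,z^k)\}$ be generated by the accelerated fixed-point (AFP) scheme of the context using the inconsistent estimator $$\widetilde G^k:=\frac1n\sum_{i=1}^nG_iy^{k-\tau_{i,k}},$$ with integer delays $0\le\tau_{i,k}\le\tau$ for $i\in\{1,\dots,n\}$, and with parameters $t_k:=k+3s+\tau$, $\gamma_k:=\gamma$, $\eta_k:=\frac{\eta t_k}{2(t_k-s)}$, where $0<\eta\le\bar\eta$. Let $x^\star\in\mathrm{zer}(G)$. Then: (i) (Convergence in expectation.) For $\mathcal{R}_0^2:=\frac{\eta(3s+\tau-1)^2}{2}\|Gy^0\|^2+\frac{2s^3}{\eta\gamma}\|y^0-x^\star\|^2$,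 $$\mathbb{E}[\|Gy^k\|^2]\le\frac{4\mathcal{R}_0^2}{\eta(k+3s+\tau-1)^2}\qquad\text{and}\qquad\lim_{k\to\infty}(k+\tau)^2\,\mathbb{E}[\|Gy^k\|^2]=0.$$ (ii) (Almost sure convergence.) Almost surely, $\sum_{k=0}^\infty(k+\tau)\|Gy^k\|^2<+\infty$ and $\lim_{k\to\infty}(k+\tau)^2\|Gy^k\|^2=0$. Moreover, $\{x^k\}$, $\{y^k\}$ and $\{z^k\}$ converge almost surely to a $\mathrm{zer}(G)$-valued random variable, i.e. a zero of $G$. (iii) (Iteration-complexity.) For a given tolerance $\epsilon>0$, the total number of iterations $k$ to achieve $\mathbb{E}[\|Gy^k\|^2]\le\epsilon^2$ is at most $$k:=\begin{cases}\mathcal{O}\big(\frac{\tau}{\epsilon}+\frac{\tau}{\bar\beta\epsilon}\big)&\text{if }0<\bar\beta\le\frac{7\Lambda\tau\beta}{3(1+\tau)},\\[1ex]\mathcal{O}\big(\frac{\tau}{\epsilon}+\frac{\tau}{\beta\epsilon}\big)&\text{if }\bar\beta\ge\frac{7\Lambda\tau\beta}{3(1+\tau)}.\end{cases}$$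
   Context: AFP scheme. Given a constant $s>1$ and an initial point $y^0\in\mathbb{R}^p$, set $z^0:=y^0$. At each iteration $k\ge0$, with $\widetilde G^k$ an estimator of $Gy^k$, $$x^{k+1}:=y^k-\eta_k\widetilde G^k,\qquad z^{k+1}:=z^k+\tfrac{\gamma_k}{s}(x^{k+1}-y^k),\qquad y^{k+1}:=\tfrac{t_k-s}{t_k}x^{k+1}+\tfrac{s}{t_k}z^{k+1}.$$ Convention: $y^{j}:=y^0$ for $j<0$. The delays may be random (the randomness comes from which component is updated at each iteration); expectations and "almost surely" refer to this randomness. *)

theory Defs
  imports "HOL-Probability.Probability"
begin

definition zer :: "('v \<Rightarrow> 'v::zero) \<Rightarrow> 'v set" where
  "zer G = {x. G x = 0}"

definition finite_sum_form :: "nat \<Rightarrow> (nat \<Rightarrow> 'v \<Rightarrow> 'v::real_vector) \<Rightarrow> ('v \<Rightarrow> 'v) \<Rightarrow> bool" where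
  "finite_sum_form n Gs G \<longleftrightarrow> (\<forall>x. G x = (1 / real n) *\<^sub>R (\<Sum>i=1..n. Gs i x))"

definition finite_sum_cocoercive ::
  "real \<Rightarrow> real \<Rightarrow> nat \<Rightarrow> (nat \<Rightarrow> 'v \<Rightarrow> 'v::real_inner) \<Rightarrow> ('v \<Rightarrow> 'v) \<Rightarrow> bool" where
  "finite_sum_cocoercive \<beta> \<beta>' n Gs G \<longleftrightarrow>
     (\<forall>x y. inner (G x - G y) (x - y) \<ge>
        \<beta> * (norm (G x - G y))\<^sup>2 + \<beta>' / real n * (\<Sum>i=1..n. (norm (Gs i x - Gs i y))\<^sup>2))"

(* The iterate x 0 does not occur in the scheme and is left arbitrary. *)
definition afp_scheme ::
  "real \<Rightarrow> (nat \<Rightarrow> real) \<Rightarrow> (nat \<Rightarrow> real) \<Rightarrow> (nat \<Rightarrow> real) \<Rightarrow> 'v \<Rightarrow> (nat \<Rightarrow> 'v)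
     \<Rightarrow> (nat \<Rightarrow> 'v) \<Rightarrow> (nat \<Rightarrow> 'v) \<Rightarrow> (nat \<Rightarrow> 'v::real_vector) \<Rightarrow> bool" where
  "afp_scheme s t \<gamma> \<eta> y0 Gt x y z \<longleftrightarrow>
     y 0 = y0 \<and> z 0 = y0 \<and>
     (\<forall>k. x (Suc k) = y k - \<eta> k *\<^sub>R Gt k \<and>
          z (Suc k) = z k + (\<gamma> k / s) *\<^sub>R (x (Suc k) - y k) \<and>
          y (Suc k) = ((t k - s) / t k) *\<^sub>R x (Suc k) + (s / t k) *\<^sub>R z (Suc k))"

(* d i k is the delay of component i at iteration k. The truncated subtraction k - d i k
   on nat implements the convention that y at a negative index is y 0. *)
definition delayed_estimator ::
  "nat \<Rightarrow> (nat \<Rightarrow> 'v \<Rightarrow> 'v::real_vector) \<Rightarrow> (nat \<Rightarrow> nat \<Rightarrow> nat) \<Rightarrow> (nat \<Rightarrow> 'v) \<Rightarrow> nat \<Rightarrow> 'v" where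
  "delayed_estimator n Gs d y k = (1 / real n) *\<^sub>R (\<Sum>i=1..n. Gs i (y (k - d i k)))"

definition t_par :: "real \<Rightarrow> real \<Rightarrow> nat \<Rightarrow> real" where
  "t_par s \<tau> k = real k + 3 * s + \<tau>"

definition eta_par :: "real \<Rightarrow> real \<Rightarrow> real \<Rightarrow> nat \<Rightarrow> real" where
  "eta_par s \<tau> \<eta> k = \<eta> * t_par s \<tau> k / (2 * (t_par s \<tau> k - s))"

definition threshold :: "real \<Rightarrow> real \<Rightarrow> real \<Rightarrow> real \<Rightarrow> real" where
  "threshold \<gamma> s \<tau> \<beta> = 7 * (1 + s - \<gamma>) * \<tau> * \<beta> / (3 * (1 + \<tau>))"

(* If \<beta>' = 0 < \<beta> neither regime applies; the value 0 then makes the step-size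
   condition 0 < \<eta> \<le> eta_bar unsatisfiable. At \<beta>' = threshold both formulas agree. *)
definition eta_bar :: "real \<Rightarrow> real \<Rightarrow> real \<Rightarrow> real \<Rightarrow> real \<Rightarrow> real" where
  "eta_bar \<gamma> s \<tau> \<beta> \<beta>' =
     (if 0 < \<beta>' \<and> \<beta>' \<le> threshold \<gamma> s \<tau> \<beta> then 3 * \<beta>' / (7 * (1 + s - \<gamma>) * \<tau>)
      else if \<beta>' \<ge> threshold \<gamma> s \<tau> \<beta> then \<beta> / (1 + \<tau>)
      else 0)"

definition R0_sq :: "real \<Rightarrow> real \<Rightarrow> real \<Rightarrow> real \<Rightarrow> ('v \<Rightarrow> 'v::real_normed_vector) \<Rightarrow> 'v \<Rightarrow> 'v \<Rightarrow> real" where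
  "R0_sq \<gamma> s \<tau> \<eta> G y0 xs =
     \<eta> * (3 * s + \<tau> - 1)\<^sup>2 / 2 * (norm (G y0))\<^sup>2 + 2 * s ^ 3 / (\<eta> * \<gamma>) * (norm (y0 - xs))\<^sup>2"

end

theory Submission
  imports Defs
begin

text \<open>
  Every assertion holds on each sample path, with bounds that do not depend on the path; the
  probabilistic statements follow by integration and dominated convergence.

  On a path put \<open>g\<^sub>k = G y\<^sup>k\<close> and \<open>v\<^sub>k = s (z\<^sup>k - y\<^sup>k)\<close>. The Lyapunov function is
  \<open>(\<eta>/4) (t\<^sub>k - 1) b\<^sub>k |g\<^sub>k|\<^sup>2 - b\<^sub>k \<langle>g\<^sub>k, v\<^sub>k\<rangle> + c\<^sub>k |z\<^sup>k - x\<^sup>*|\<^sup>2\<close> with \<open>b\<^sub>k = t\<^sub>k - 1 + h\<close>. The weights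
  \<open>c\<^sub>k\<close> are forced by cancelling \<open>\<langle>g\<^sub>k, v\<^sub>k\<rangle>\<close> against the drift of \<open>|z\<^sup>k - x\<^sup>*|\<^sup>2\<close>, and the shift \<open>h\<close> makes
  them decrease fast enough to absorb the pairing of the delay error \<open>e\<^sub>k = g\<^sub>k - q\<^sub>k\<close>, where \<open>q\<^sub>k\<close> is the
  delayed estimator, with the unbounded quantity \<open>z\<^sup>k\<^sup>+\<^sup>1 - x\<^sup>*\<close>. What remains of the error is a
  multiple of \<open>t\<^sub>k\<^sup>2 |e\<^sub>k|\<^sup>2 / \<tau>\<close>, and this is paid for by the component increments
  \<open>U\<^sub>j = (1/n) \<Sum>\<^sub>i |G\<^sub>i y\<^sup>j\<^sup>+\<^sup>1 - G\<^sub>i y\<^sup>j|\<^sup>2\<close> from the cocoercivity inequality, because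
  \<open>|e\<^sub>k|\<^sup>2 \<le> \<tau> (U\<^sub>k\<^sub>-\<^sub>\<tau> + \<dots> + U\<^sub>k\<^sub>-\<^sub>1)\<close> and \<open>(t + 1)\<^sup>2 + \<dots> + (t + \<tau>)\<^sup>2 \<le> (7/3) \<tau> t (t - s)\<close>;
  this is the source of the factor \<open>3/7\<close> in the step size.

  Summability of \<open>t\<^sub>k |g\<^sub>k|\<^sup>2\<close> and \<open>t\<^sub>k\<^sup>2 |e\<^sub>k|\<^sup>2\<close> makes \<open>v\<^sub>k\<close> tend to \<open>0\<close>, as \<open>v\<^sub>k\<^sub>+\<^sub>1\<close> is a convex
  combination of \<open>v\<^sub>k\<close> and a multiple of \<open>t\<^sub>k q\<^sub>k\<close>, and makes \<open>|z\<^sup>k - x\<^sup>*|\<close> converge for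
  every zero \<open>x\<^sup>*\<close>. Hence \<open>t\<^sub>k\<^sup>2 |g\<^sub>k|\<^sup>2\<close> converges too, necessarily to \<open>0\<close> since the harmonic series
  diverges, and the iterates converge by Opial's argument.
\<close>

lemma sum_shifted_squares:
  fixes t :: real
  shows "(\<Sum>i=1..T. (t + real i)\<^sup>2) = real T * (t\<^sup>2 + t * (real T + 1) + (real T + 1) * (2 * real T + 1) / 6)"
  by (induction T) (simp_all add: field_simps power2_eq_square)

section \<open>Inequalities between the parameters\<close>

text \<open>The upper bound on the step size enters only through the last two assumptions. Both hold
  in either regime of \<open>eta_bar\<close>, so the convergence analysis never distinguishes the
  regimes.\<close>

locale afp_params =
  fixes \<gamma> s \<tau> \<eta> \<beta> \<beta>' :: real
  assumes \<gamma>_pos: "0 < \<gamma>" and \<gamma>_le: "\<gamma> \<le> 1" and s_ge: "1 + 3 * \<gamma> \<le> s" and \<tau>_ge: "1 \<le> \<tau>"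
    and \<eta>_pos: "0 < \<eta>" and \<eta>_\<beta>: "\<eta> * (1 + \<tau>) \<le> \<beta>"
    and \<eta>_\<beta>': "7 * (1 + s - \<gamma>) * \<tau> * \<eta> \<le> 3 * \<beta>'"
begin

text \<open>Along the scheme \<open>\<mu> t\<^sub>k = b\<^sub>k\<^sub>+\<^sub>1 / t\<^sub>k\<close>, \<open>\<delta> t\<^sub>k = b\<^sub>k - (t\<^sub>k - s) \<mu> t\<^sub>k\<close> is the coefficient left
  at \<open>\<langle>g\<^sub>k, v\<^sub>k\<rangle>\<close>, and \<open>\<kappa>\<close> is \<open>c\<close> without its factor \<open>s\<^sup>2 / (\<gamma> \<eta>)\<close>. The summand \<open>3 (s - 1)\<close> of \<open>h\<close> is what
  makes \<open>\<kappa>\<close> decrease when \<open>s\<close> dominates \<open>\<tau>\<close>, the summand \<open>2 \<tau> / 5\<close> accounts for the delays.\<close>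
definition h :: real where "h = 3 * (s - 1) + 2 / 5 * \<tau>"
definition \<mu> :: "real \<Rightarrow> real" where "\<mu> t = 1 + h / t"
definition \<delta> :: "real \<Rightarrow> real" where "\<delta> t = s - 1 + h * s / t"
definition \<kappa> :: "real \<Rightarrow> real" where "\<kappa> t = \<delta> t * (1 - s / t)"

lemma s_gt: "1 < s" using \<gamma>_pos s_ge by linarith

lemma h_nonneg: "0 \<le> h" using s_gt \<tau>_ge by (simp add: h_def)

lemma h_less: "3 * s + \<tau> \<le> t \<Longrightarrow> h < t"
  using s_gt \<tau>_ge by (simp add: h_def)

lemma \<mu>_ge: "3 * s + \<tau> \<le> t \<Longrightarrow> 1 \<le> \<mu> t"
  using s_gt \<tau>_ge h_nonneg by (simp add: \<mu>_def)

lemma \<mu>_antimono: "3 * s + \<tau> \<le> t \<Longrightarrow> t \<le> t' \<Longrightarrow> \<mu> t' \<le> \<mu> t"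
  using s_gt \<tau>_ge h_nonneg by (simp add: \<mu>_def frac_le)

lemma \<delta>_eq: "\<delta> t = s * \<mu> t - 1"
  by (simp add: \<delta>_def \<mu>_def algebra_simps)

lemma \<delta>_ge: "3 * s + \<tau> \<le> t \<Longrightarrow> s - 1 \<le> \<delta> t"
  using s_gt \<tau>_ge h_nonneg by (simp add: \<delta>_def)

text \<open>As \<open>\<mu>\<close> is antitone, the smallest argument \<open>3 * s + \<tau>\<close>
  decides; there the cleared inequality has the surplus
  \<open>6/5 * s + 3/5 * (s - 1) * \<tau>\<close>.\<close>

lemma \<mu>_upper:
  assumes "3 * s + \<tau> \<le> t" shows "s * \<mu> t \<le> 7 / 5 * s + 3 / 5 * (s - 1)"
proof -
  have t: "0 < 3 * s + \<tau>" using s_gt \<tau>_ge by linarith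
  have "h * s \<le> (2 / 5 * s + 3 / 5 * (s - 1)) * (3 * s + \<tau>)"
  proof -
    have "(2 / 5 * s + 3 / 5 * (s - 1)) * (3 * s + \<tau>) - h * s = 6/5 * s + 3 / 5 * (s - 1) * \<tau>"
      by (simp add: h_def field_simps)
    moreover have "0 \<le> (s - 1) * \<tau>" using s_gt \<tau>_ge by simp
    ultimately show ?thesis using s_gt by linarith
  qed
  then have "h * s / (3 * s + \<tau>) \<le> 2 / 5 * s + 3 / 5 * (s - 1)"
    using t by (simp add: pos_divide_le_eq)
  moreover have "s * \<mu> t \<le> s * \<mu> (3 * s + \<tau>)"
    using \<mu>_antimono[of "3 * s + \<tau>" t] assms s_gt by simp
  ultimately show ?thesis by (simp add: \<mu>_def algebra_simps)
qed

text \<open>Later the squares are those of the steps whose delay window contains a given increment.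
  The constant 7/3 is sharp: for large \<tau>, \<open>t = 3 * s + \<tau>\<close> and
  \<open>T = \<tau>\<close> both sides grow like 7/3 times the cube of \<tau>.\<close>

lemma window_sum:
  assumes t: "3 * s + \<tau> \<le> t" and T: "real T \<le> \<tau>"
  shows "(\<Sum>i=1..T. (t + real i)\<^sup>2) \<le> 7 / 3 * \<tau> * t * (t - s)"
proof -
  \<comment> \<open>Measured from the extreme values \<open>t = 3 * s + \<tau>\<close>,
    \<open>s = 1\<close>, \<open>\<tau> = 1\<close>, the difference bounded below is a polynomial
    with nonnegative coefficients.\<close>
  define w a b where "w = t - (3 * s + \<tau>)" and "a = s - 1" and "b = \<tau> - 1"
  have nn: "0 \<le> w" "0 \<le> a" "0 \<le> b" using t s_gt \<tau>_ge by (auto simp: w_def a_def b_def)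
  have e: "\<tau> = 1 + b" "s = 1 + a" "t = 4 + 3 * a + b + w" by (auto simp: w_def a_def b_def)
  let ?q = "\<lambda>T. t\<^sup>2 + t * (T + 1) + (T + 1) * (2 * T + 1) / 6"
  have t0: "0 \<le> t" using t s_gt \<tau>_ge by linarith
  have "?q (real T) \<le> ?q \<tau>"
    using T t0 \<tau>_ge by (intro add_mono mult_left_mono divide_right_mono mult_mono) auto
  moreover have "0 \<le> 7 / 3 * t * (t - s) - ?q \<tau>"
    unfolding e power2_eq_square using nn
    by (simp add: field_simps)
  ultimately have q: "?q (real T) \<le> 7 / 3 * t * (t - s)" by linarith
  have "real T * ?q (real T) \<le> \<tau> * (7 / 3 * t * (t - s))"
    using T q t0 \<tau>_ge by (intro mult_mono) auto
  then show ?thesis unfolding sum_shifted_squares by (simp only: mult_ac)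
qed

text \<open>This is what \<open>drift_absorbs_delay\<close> requires at
  \<open>t = 3 * s + \<tau>\<close>, divided by \<tau>. The expression decreases in \<gamma>, so
  \<gamma> may be raised to one of its upper bounds 1 and \<open>(s - 1) / 3\<close>.\<close>

lemma drift_core:
  "0 \<le> 4 * (s - \<gamma>) * (2 / 5 * s + 2 * (s - 1) + 2 / 5 * \<tau>)
     - \<gamma> * (6 * (s - 1) * s + \<tau> * (7 / 5 * s - 1) + (s - 1) + s)" (is "0 \<le> ?X \<gamma>")
proof -
  define r b where "r = s - 1" and "b = \<tau> - 1"
  have e: "s = 1 + r" "\<tau> = 1 + b" by (auto simp: r_def b_def)
  have nn: "0 < r" "0 \<le> b" "3 * \<gamma> \<le> r" using s_gt \<tau>_ge s_ge by (auto simp: r_def b_def)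
  have mono: "?X c \<le> ?X \<gamma>" if "\<gamma> \<le> c" for c
  proof -
    have "0 \<le> (c - \<gamma>) * (4 * (2 / 5 * s + 2 * (s - 1) + 2 / 5 * \<tau>)
       + (6 * (s - 1) * s + \<tau> * (7 / 5 * s - 1) + (s - 1) + s))"
      using that nn unfolding e by (intro mult_nonneg_nonneg add_nonneg_nonneg) auto
    also have "\<dots> = ?X \<gamma> - ?X c" by (simp add: field_simps)
    finally show ?thesis by simp
  qed
  show ?thesis
  \<comment> \<open>At \<open>r = 3\<close> the two upper bounds 1 and \<open>r / 3\<close> of
    \<gamma> coincide; in each case the smaller one is used.\<close>
  proof (cases "3 \<le> r")
    case True
    define q where "q = r - 3"
    have q: "0 \<le> q" "r = 3 + q" using True by (auto simp: q_def)
    have "0 \<le> ?X 1" unfolding e q(2) using q(1) nn(2) by (simp add: field_simps)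
    then show ?thesis using mono[of 1] \<gamma>_le by linarith
  next
    case False
    have "15 * ?X (r / 3) = 48 + 46 * r + r * (3 - r) * (41 + 30 * r)
        + b * (7 * (r * (3 - r)) + (24 - 7 * r))"
      unfolding e by (simp add: field_simps)
    moreover have "0 \<le> 48 + 46 * r + r * (3 - r) * (41 + 30 * r)
        + b * (7 * (r * (3 - r)) + (24 - 7 * r))"
      using False nn by (intro add_nonneg_nonneg mult_nonneg_nonneg) auto
    ultimately have "0 \<le> 15 * ?X (r / 3)" by (simp only:)
    then have "0 \<le> ?X (r / 3)" by (simp only: zero_le_mult_iff) simp
    then show ?thesis using mono[of "r / 3"] nn by linarith
  qed
qed

text \<open>Once \<open>\<delta> t * (t + 1)\<close> is bounded by an affine function of
  \<open>t\<close>, both sides are affine, and it suffices to compare the slopes and the values at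
  \<open>t0\<close>.\<close>

lemma drift_absorbs_delay:
  assumes t: "3 * s + \<tau> \<le> t"
  shows "\<gamma> * \<tau> * \<delta> t * (t + 1) \<le> 4 * (s - \<gamma>) * ((h - (s - 1)) * t - 2 * h * s)"
proof -
  define N where "N = h - (s - 1)"
  define t0 where "t0 = 3 * s + \<tau>"
  have t_pos: "0 < t" using t s_gt \<tau>_ge by linarith
  have "h * s / t \<le> s" using h_less[OF t] t_pos s_gt by (simp add: field_simps)
  moreover have "\<delta> t * (t + 1) = (s - 1) * t + (s - 1) + h * s + h * s / t"
    using t_pos by (simp add: \<delta>_def divide_simps) algebra
  ultimately have "\<delta> t * (t + 1) \<le> (s - 1) * t + (s - 1) + h * s + s" by linarith
  then have 1: "\<gamma> * \<tau> * (\<delta> t * (t + 1)) \<le> \<gamma> * \<tau> * ((s - 1) * t + (s - 1) + h * s + s)"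
    using \<gamma>_pos \<tau>_ge by (intro mult_left_mono) auto
  have "\<gamma> * \<tau> * (s - 1) \<le> 1 * \<tau> * (s - 1)"
    using \<gamma>_le \<tau>_ge s_gt by (intro mult_right_mono) auto
  also have "\<dots> \<le> 4 * (s - 1) * (2 / 5 * \<tau>)" using \<tau>_ge s_gt by simp
  also have "\<dots> \<le> 4 * (s - \<gamma>) * N"
    using \<tau>_ge s_gt \<gamma>_le by (intro mult_mono) (auto simp: N_def h_def)
  finally have slope: "0 \<le> 4 * (s - \<gamma>) * N - \<gamma> * \<tau> * (s - 1)" by simp
  \<comment> \<open>The summand \<open>3 * (s - 1)\<close> of \<open>h\<close> makes the terms of
    \<open>N * t0 - 2 * h * s\<close> free of \<tau> cancel, so a factor \<tau> can be split
    off.\<close>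
  have "0 \<le> \<tau> * (4 * (s - \<gamma>) * (2 / 5 * s + 2 * (s - 1) + 2 / 5 * \<tau>)
     - \<gamma> * (6 * (s - 1) * s + \<tau> * (7 / 5 * s - 1) + (s - 1) + s))"
    using drift_core \<tau>_ge by simp
  also have "\<dots> = 4 * (s - \<gamma>) * (N * t0 - 2 * h * s)
      - \<gamma> * \<tau> * ((s - 1) * t0 + (s - 1) + h * s + s)"
    by (simp add: N_def t0_def h_def field_simps)
  finally have start: "0 \<le> \<dots>" .
  have "0 \<le> (4 * (s - \<gamma>) * N - \<gamma> * \<tau> * (s - 1)) * (t - t0)"
    using slope t by (simp add: t0_def)
  with start have "\<gamma> * \<tau> * ((s - 1) * t + (s - 1) + h * s + s) \<le> 4 * (s - \<gamma>) * (N * t - 2 * h * s)"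
    by (simp add: algebra_simps)
  with 1 show ?thesis by (simp add: N_def mult_ac)
qed

text \<open>This is the discriminant condition under which the drop of the weight of the squared
  distance to a zero absorbs the pairing of the delay error with the next \<open>z\<close>.\<close>

lemma \<kappa>_drop:
  assumes t: "3 * s + \<tau> \<le> t"
  shows "\<gamma> * (\<delta> t)\<^sup>2 * \<tau> \<le> 4 * (s - \<gamma>) * \<mu> t * t\<^sup>2 * (\<kappa> t - \<kappa> (t + 1))"
proof -
  define N where "N = h - (s - 1)"
  have t_pos: "0 < t" using t s_gt \<tau>_ge by linarith
  have "t\<^sup>2 * (\<kappa> t - \<kappa> (t + 1)) * (t + 1) = s * (N * t - h * s * ((2 * t + 1) / (t + 1)))"
    using t_pos by (simp add: \<kappa>_def \<delta>_def N_def divide_simps) algebra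
  moreover have "h * s * ((2 * t + 1) / (t + 1)) \<le> h * s * 2"
    using t_pos h_nonneg s_gt by (intro mult_left_mono) (auto simp: field_simps)
  ultimately have A: "s * (N * t - 2 * h * s) \<le> t\<^sup>2 * (\<kappa> t - \<kappa> (t + 1)) * (t + 1)"
    using s_gt by simp
  have \<mu>0: "0 \<le> \<mu> t" and \<delta>0: "0 \<le> \<delta> t" using \<mu>_ge[OF t] \<delta>_ge[OF t] s_gt by auto
  have sg: "0 \<le> s - \<gamma>" using s_gt \<gamma>_le by linarith
  have "\<gamma> * (\<delta> t)\<^sup>2 * \<tau> * (t + 1) = (\<gamma> * \<tau> * \<delta> t * (t + 1)) * \<delta> t"
    by (simp add: power2_eq_square)
  \<comment> \<open>Only one of the two factors \<delta> is enlarged, which supplies the factor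
    \<mu> of the right side.\<close>
  also have "\<dots> \<le> (\<gamma> * \<tau> * \<delta> t * (t + 1)) * (s * \<mu> t)"
    using \<gamma>_pos \<tau>_ge \<delta>0 t_pos by (intro mult_left_mono) (auto simp: \<delta>_eq)
  also have "\<dots> \<le> (4 * (s - \<gamma>) * (N * t - 2 * h * s)) * (s * \<mu> t)"
    using drift_absorbs_delay[OF t] s_gt \<mu>0 by (intro mult_right_mono) (auto simp: N_def)
  also have "\<dots> = 4 * (s - \<gamma>) * \<mu> t * (s * (N * t - 2 * h * s))" by simp
  also have "\<dots> \<le> 4 * (s - \<gamma>) * \<mu> t * (t\<^sup>2 * (\<kappa> t - \<kappa> (t + 1)) * (t + 1))"
    using A sg \<mu>0 by (intro mult_left_mono) auto
  also have "\<dots> = 4 * (s - \<gamma>) * \<mu> t * t\<^sup>2 * (\<kappa> t - \<kappa> (t + 1)) * (t + 1)" by simp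
  finally show ?thesis using t_pos by simp
qed

text \<open>The bound is the limit of \<kappa> at infinity and keeps the weights \<open>c\<close>
  away from 0. The cleared difference is affine in \<open>t\<close> with nonnegative slope, so the
  smallest \<open>t\<close> decides.\<close>

lemma \<kappa>_ge:
  assumes t: "3 * s + \<tau> \<le> t" shows "s - 1 \<le> \<kappa> t"
proof -
  have t_pos: "0 < t" using t s_gt \<tau>_ge by linarith
  have "(s - 1) * (3 * s + \<tau>) \<le> h * (2 * s + \<tau>)"
  proof -
    have "h * (2 * s + \<tau>) - (s - 1) * (3 * s + \<tau>)
        = 3 * (s - 1) * s + 2 * (s - 1) * \<tau> + 2 / 5 * \<tau> * (2 * s + \<tau>)"
      by (simp add: h_def field_simps)
    moreover have "0 \<le> 3 * (s - 1) * s + 2 * (s - 1) * \<tau> + 2 / 5 * \<tau> * (2 * s + \<tau>)"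
      using s_gt \<tau>_ge by simp
    ultimately show ?thesis by linarith
  qed
  moreover have "(h - (s - 1)) * (3 * s + \<tau>) \<le> (h - (s - 1)) * t"
    using t s_gt \<tau>_ge by (intro mult_left_mono) (auto simp: h_def)
  ultimately have "h * s \<le> (h - (s - 1)) * t" by (simp add: algebra_simps)
  then have "0 \<le> s * ((h - (s - 1)) * t - h * s)" using s_gt by simp
  also have "\<dots> = t\<^sup>2 * (\<kappa> t - (s - 1))"
    using t_pos by (simp add: \<kappa>_def \<delta>_def power2_eq_square field_simps)
  finally show ?thesis using t_pos by (simp add: zero_le_mult_iff)
qed

text \<open>Up to the factor \<open>\<eta> / 4\<close>, the left side is what Young's inequality for
  the pairing of \<open>g\<close> with the delay error leaves at the squared norm of
  \<open>g\<close>. It is paid by a gain due to the shift \<open>h\<close> and by the cocoercivity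
  term of \<open>z_step\<close>.\<close>

lemma residual_absorbs_delay:
  assumes t: "3 * s + \<tau> \<le> t"
  shows "2 / 7 * (s - \<gamma>)\<^sup>2 * \<mu> t * \<tau>
     \<le> h * (2 * (s - \<gamma>) - 1) + 1 + 4 * s * \<delta> t * (5 / 8 + \<tau>)"
proof -
  have "(s - \<gamma>)\<^sup>2 * \<mu> t \<le> s\<^sup>2 * \<mu> t"
    using s_gt \<gamma>_pos \<gamma>_le \<mu>_ge[OF t] by (intro mult_right_mono power_mono) auto
  also have "\<dots> = s * (s * \<mu> t)" by (simp add: power2_eq_square)
  also have "\<dots> \<le> s * (7 / 5 * s + 3 / 5 * (s - 1))"
    using \<mu>_upper[OF t] s_gt by (intro mult_left_mono) auto
  finally have "2 / 7 * ((s - \<gamma>)\<^sup>2 * \<mu> t) \<le> 2 / 7 * (s * (7 / 5 * s + 3 / 5 * (s - 1)))"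
    by (intro mult_left_mono) auto
  also have "\<dots> \<le> 2 / 5 + 4 * s * (s - 1)"
  proof -
    have "0 \<le> (s - 1) * (4 * s - 6 / 35 * s - 2 / 5 * s - 2 / 5)" using s_gt by simp
    then show ?thesis by (simp add: field_simps)
  qed
  also have "\<dots> \<le> 2 / 5 + 4 * s * \<delta> t"
    using \<delta>_ge[OF t] s_gt by simp
  finally have "2 / 7 * ((s - \<gamma>)\<^sup>2 * \<mu> t) * \<tau> \<le> (2 / 5 + 4 * s * \<delta> t) * \<tau>"
    using \<tau>_ge by (intro mult_right_mono) auto
  also have "\<dots> = 2 / 5 * \<tau> * 1 + 4 * s * \<delta> t * \<tau>" by (simp add: algebra_simps)
  \<comment> \<open>The summand \<open>2 / 5 * \<tau>\<close> of \<open>h\<close> is spent here,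
    with \<open>1 \<le> 2 * (s - \<gamma>) - 1\<close>.\<close>
  also have "\<dots> \<le> h * (2 * (s - \<gamma>) - 1) + 4 * s * \<delta> t * (5 / 8 + \<tau>)"
    using s_gt \<tau>_ge \<gamma>_le s_ge \<gamma>_pos \<delta>_ge[OF t]
    by (intro add_mono mult_mono mult_left_mono) (auto simp: h_def)
  finally show ?thesis by (simp add: mult_ac)
qed

text \<open>For large \<tau> the left side tends to \<open>7 / 5 * (s - 1) + 2 / 5\<close>. The
  slightly larger slope 22/15 reduces the coefficient of \<tau> in the cleared difference to
  \<open>8 / 5 * s\<close>.\<close>

lemma \<kappa>_init: "\<kappa> (3 * s + \<tau>) \<le> 22 / 15 * (s - 1) + 2 / 5"
proof -
  define r where "r = s - 1"
  have e: "s = 1 + r" by (simp add: r_def)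
  have r: "0 < r" using s_gt e by simp
  have t_pos: "0 < 3 * s + \<tau>" using s_gt \<tau>_ge by linarith
  have "((22 / 15 * (s - 1) + 2 / 5) - \<kappa> (3 * s + \<tau>)) * (3 * s + \<tau>)\<^sup>2
     = (22 / 15 * (s - 1) + 2 / 5) * (3 * s + \<tau>)\<^sup>2
       - ((s - 1) * (3 * s + \<tau>) + h * s) * (2 * s + \<tau>)"
    using t_pos by (simp add: \<kappa>_def \<delta>_def power2_eq_square divide_simps)
  also have "\<dots> = s\<^sup>2 * (18 / 5 + 6 / 5 * r) + 8 / 5 * s * \<tau> + r / 15 * \<tau>\<^sup>2"
    unfolding h_def unfolding e by (simp add: power2_eq_square field_simps)
  finally have "0 \<le> ((22 / 15 * (s - 1) + 2 / 5) - \<kappa> (3 * s + \<tau>)) * (3 * s + \<tau>)\<^sup>2"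
    using r s_gt \<tau>_ge by simp
  then show ?thesis using t_pos by (simp add: zero_le_mult_iff)
qed

text \<open>In \<open>lyap_init\<close> the first summand is the part of the residual term that is
  traded for the distance term, the second comes from \<open>c\<close>. As in
  \<open>drift_core\<close>, \<gamma> is replaced by 1 or \<open>(s - 1) / 3\<close>, inserted for
  \<open>m\<close> in \<open>key\<close>.\<close>

lemma initial_budget:
  "\<gamma> * (3 / 8 * (s - 1 + 1 / 15)) + s * \<kappa> (3 * s + \<tau>) \<le> 2 * s\<^sup>2 * (1 - \<gamma> / (s - 1))"
proof -
  define r where "r = s - 1"
  have e: "s = 1 + r" by (simp add: r_def)
  have r: "0 < r" "\<gamma> \<le> r / 3" using s_gt s_ge e by auto
  have key: "m * (3 / 8 * (r + 1 / 15) * r + 2 * s\<^sup>2) \<le> r * s * (8 / 5 + 8 / 15 * r) \<Longrightarrow> \<gamma> \<le> m \<Longrightarrow> ?thesis" for m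
  proof -
    assume m: "m * (3 / 8 * (r + 1 / 15) * r + 2 * s\<^sup>2) \<le> r * s * (8 / 5 + 8 / 15 * r)" "\<gamma> \<le> m"
    have "\<gamma> * (3 / 8 * (r + 1 / 15) * r + 2 * s\<^sup>2) \<le> m * (3 / 8 * (r + 1 / 15) * r + 2 * s\<^sup>2)"
      using m(2) r by (intro mult_right_mono) auto
    with m(1) have *: "\<gamma> * (3 / 8 * (r + 1 / 15) * r + 2 * s\<^sup>2) \<le> r * s * (8 / 5 + 8 / 15 * r)" by linarith
    have "r * (\<gamma> * (3 / 8 * (r + 1 / 15)) + s * \<kappa> (3 * s + \<tau>))
       \<le> r * (\<gamma> * (3 / 8 * (r + 1 / 15)) + s * (22 / 15 * (s - 1) + 2 / 5))"
      using \<kappa>_init r s_gt by (intro mult_left_mono add_left_mono) auto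
    also have "\<dots> \<le> 2 * s\<^sup>2 * (r - \<gamma>)"
      using * by (simp add: e power2_eq_square field_simps)
    also have "\<dots> = r * (2 * s\<^sup>2 * (1 - \<gamma> / r))"
      using r by (simp add: field_simps)
    finally show ?thesis using r by (simp add: r_def)
  qed
  show ?thesis
  proof (cases "3 \<le> r")
    case True
    define q where "q = r - 3"
    have q: "0 \<le> q" "r = 3 + q" using True by (auto simp: q_def)
    show ?thesis
      by (rule key[of 1]) (use \<gamma>_le q(1) in \<open>simp_all add: e q(2) power2_eq_square field_simps\<close>)
  next
    case False
    have "0 \<le> r * (14 / 15 + 19 / 24 * r - 31 / 120 * r\<^sup>2)"
    proof -
      have "r\<^sup>2 \<le> 3 * r" using False r unfolding power2_eq_square by (intro mult_right_mono) auto
      then show ?thesis using r by (intro mult_nonneg_nonneg) linarith+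
    qed
    then show ?thesis
      by (intro key[of "r / 3"]) (use r in \<open>simp_all add: e power2_eq_square field_simps\<close>)
  qed
qed

end

section \<open>One step of the Lyapunov function\<close>

text \<open>The vector \<open>p\<close> stands for the displacement of \<open>y\<close>. The product
  of \<open>g'\<close> with \<open>p\<close> is split: the part with \<open>g' - g\<close> is kept
  for cocoercivity, the part with \<open>g\<close> is rewritten by the first equation in terms of
  \<open>v\<close> and \<open>q\<close>.\<close>

lemma afp_step_identity:
  fixes g g' q v v' p :: "'v::real_inner"
  assumes "t > s" "t > 0"
    and v: "t *\<^sub>R p = v - (\<eta> * t / 2 + \<gamma> * (\<eta> * t / (2 * (t - s)))) *\<^sub>R q"
    and v': "v' = (t - s) *\<^sub>R p + (\<eta> * t / 2) *\<^sub>R q"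
  shows "t * inner g' v' = (t - s) * inner g v + \<eta> * t\<^sup>2 / 2 * inner g' q
     - \<eta> * t / 2 * (t - s + \<gamma>) * inner g q + t * (t - s) * inner (g' - g) p"
proof -
  have "t * inner g p = inner g (t *\<^sub>R p)" by simp
  also have "\<dots> = inner g v - (\<eta> * t / 2 + \<gamma> * (\<eta> * t / (2 * (t - s)))) * inner g q"
    unfolding v by (simp add: inner_diff_right)
  finally have "(t - s) * (t * inner g p)
      = (t - s) * inner g v - \<eta> * t / 2 * (t - s + \<gamma>) * inner g q"
    using assms(1) by (simp add: field_simps)
  then show ?thesis
    by (simp add: v' inner_diff_left inner_add_right algebra_simps power2_eq_square)
qed

text \<open>The discriminant condition makes the quadratic form with coefficients \<open>a\<close>,
  \<open>- c\<close>, \<open>b\<close> nonnegative. In this form the drop of the weights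
  \<open>c\<close> can serve as a coefficient.\<close>

lemma young_inner:
  fixes x y :: "'v::real_inner"
  assumes "0 \<le> a" "0 < b" "c\<^sup>2 \<le> 4 * a * b"
  shows "c * inner x y \<le> a * (norm x)\<^sup>2 + b * (norm y)\<^sup>2"
proof -
  have "c * inner x y \<le> \<bar>c\<bar> * (norm x * norm y)"
    using Cauchy_Schwarz_ineq2[of x y] by (metis abs_ge_self abs_mult mult_left_mono abs_ge_zero order_trans)
  also have "\<dots> \<le> a * (norm x)\<^sup>2 + b * (norm y)\<^sup>2"
  proof -
    have "0 \<le> (2 * b * norm y - \<bar>c\<bar> * norm x)\<^sup>2" by simp
    also have "\<dots> = 4 * b * (b * (norm y)\<^sup>2 - \<bar>c\<bar> * (norm x * norm y)) + c\<^sup>2 * (norm x)\<^sup>2"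
      by (simp add: power2_eq_square algebra_simps flip: abs_mult)
    also have "\<dots> \<le> 4 * b * (b * (norm y)\<^sup>2 - \<bar>c\<bar> * (norm x * norm y)) + 4 * a * b * (norm x)\<^sup>2"
      using assms(3) by (intro add_left_mono mult_right_mono) auto
    also have "\<dots> = 4 * b * (a * (norm x)\<^sup>2 + b * (norm y)\<^sup>2 - \<bar>c\<bar> * (norm x * norm y))"
      by (simp add: algebra_simps)
    finally show ?thesis using assms(2) by (simp add: zero_le_mult_iff)
  qed
  finally show ?thesis .
qed

context afp_params
begin

definition c :: "real \<Rightarrow> real" where "c t = s\<^sup>2 * \<kappa> t / (\<gamma> * \<eta>)"

definition lyap :: "real \<Rightarrow> 'v::real_inner \<Rightarrow> 'v \<Rightarrow> 'v \<Rightarrow> real" where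
  "lyap t g v w = \<eta> / 4 * (t - 1) * (t - 1 + h) * (norm g)\<^sup>2 - (t - 1 + h) * inner g v + c t * (norm w)\<^sup>2"

text \<open>The factor collects the cost of the delay error in \<open>lyap_step\<close>: 31/8 = 3/8
  + 7/2 from the pairings with \<open>g' - g\<close> and \<open>g\<close>, and
  \<open>4 * (s - \<gamma>)\<close> from the pairing with \<open>w'\<close>. It stays 1/8 below
  \<open>4 * (1 + s - \<gamma>)\<close>.\<close>

definition delay_weight :: "real \<Rightarrow> real" where
  "delay_weight t = \<mu> t * t\<^sup>2 * (\<eta> / 4 * (31 / 8 + 4 * (s - \<gamma>)))"

text \<open>The weight \<open>c\<close> is such that the cross term of the square has coefficient
  exactly \<open>s * \<delta> t\<close>. The error is paired with \<open>w'\<close> instead of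
  \<open>w\<close>, because the drop of \<open>c\<close> is available at \<open>w'\<close>. The
  exchange also gives the error a negative square, which is dropped.\<close>

lemma z_step:
  fixes g e v w w' :: "'v::real_inner"
  assumes t: "3 * s + \<tau> \<le> t"
    and w': "w' = w - (\<gamma> / s * (\<eta> * t / (2 * (t - s)))) *\<^sub>R (g - e)"
    and mono: "s * inner g w - inner g v \<ge> s * (\<beta> * (norm g)\<^sup>2)"
  shows "c t * (norm w')\<^sup>2 \<le> c t * (norm w)\<^sup>2 - \<delta> t * inner g v
     - s * \<delta> t * \<eta> * (5 / 8 + \<tau>) * (norm g)\<^sup>2 + s * \<delta> t * inner e w'"
proof -
  define \<omega> where "\<omega> = \<gamma> / s * (\<eta> * t / (2 * (t - s)))"
  have ts: "0 < t" "0 < t - s" using t s_gt \<tau>_ge by linarith+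
  have \<delta>0: "0 \<le> \<delta> t" using \<delta>_ge[OF t] s_gt by simp
  have c\<omega>: "2 * (c t * \<omega>) = s * \<delta> t"
    using ts s_gt \<gamma>_pos \<eta>_pos
    by (simp add: c_def \<kappa>_def \<omega>_def power2_eq_square divide_simps)
  \<comment> \<open>From \<open>3 * s \<le> t\<close> follows
    \<open>t \<le> 3 / 2 * (t - s)\<close>. Hence the quadratic term costs at most 3/8, which turns
    \<open>1 + \<tau>\<close> into \<open>5 / 8 + \<tau>\<close>.\<close>
  have \<omega>_le: "s * \<omega> \<le> 3 / 4 * \<eta>"
  proof -
    have "\<gamma> * t \<le> 1 * t" using \<gamma>_le ts by (intro mult_right_mono) auto
    also have "\<dots> \<le> 3 / 2 * (t - s)" using t \<tau>_ge by simp
    finally have "\<eta> * (\<gamma> * t) \<le> \<eta> * (3 / 2 * (t - s))" using \<eta>_pos by (intro mult_left_mono) auto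
    then have "\<eta> * (\<gamma> * t) / (2 * (t - s)) \<le> 3 / 4 * \<eta>"
      using ts by (subst pos_divide_le_eq) (auto simp: algebra_simps)
    moreover have "s * \<omega> = \<eta> * (\<gamma> * t) / (2 * (t - s))" using s_gt by (simp add: \<omega>_def)
    ultimately show ?thesis by simp
  qed
  have E1: "inner e w = inner e w' + \<omega> * inner e (g - e)"
    unfolding w' \<omega>_def[symmetric] by (simp add: inner_diff_right algebra_simps)
  have E2: "(norm w')\<^sup>2 = (norm w)\<^sup>2 - 2 * \<omega> * (inner g w - inner e w) + \<omega>\<^sup>2 * (norm (g - e))\<^sup>2"
    unfolding w' \<omega>_def[symmetric]
    by (simp only: power2_norm_eq_inner) (simp add: inner_diff_left inner_diff_right inner_commute algebra_simps power2_eq_square)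
  have E3: "inner e (g - e) = inner g e - (norm e)\<^sup>2"
    by (simp add: inner_diff_right power2_norm_eq_inner inner_commute)
  have E4: "(norm (g - e))\<^sup>2 = (norm g)\<^sup>2 - 2 * inner g e + (norm e)\<^sup>2"
    by (simp add: power2_norm_eq_inner inner_diff_left inner_diff_right inner_commute)
  have "c t * (norm w')\<^sup>2 = c t * ((norm w)\<^sup>2 - 2 * \<omega> * inner g w + 2 * \<omega> * inner e w'
      + \<omega>\<^sup>2 * ((norm g)\<^sup>2 - (norm e)\<^sup>2))"
    unfolding E2 E1 E3 E4 by (simp add: algebra_simps power2_eq_square)
  also have "\<dots> = c t * (norm w)\<^sup>2 - 2 * (c t * \<omega>) * inner g w + 2 * (c t * \<omega>) * inner e w'
      + 2 * (c t * \<omega>) * (\<omega> / 2 * ((norm g)\<^sup>2 - (norm e)\<^sup>2))"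
    by (simp add: algebra_simps power2_eq_square)
  also have "\<dots> = c t * (norm w)\<^sup>2 - \<delta> t * (s * inner g w) + s * \<delta> t * inner e w'
      + \<delta> t * (s * \<omega> / 2 * ((norm g)\<^sup>2 - (norm e)\<^sup>2))"
    unfolding c\<omega> by (simp add: algebra_simps)
  also have "\<dots> \<le> c t * (norm w)\<^sup>2 - \<delta> t * (inner g v + s * (\<eta> * (1 + \<tau>) * (norm g)\<^sup>2))
      + s * \<delta> t * inner e w' + \<delta> t * (s * \<eta> * 3 / 8 * (norm g)\<^sup>2)"
  proof -
    have "s * (\<eta> * (1 + \<tau>) * (norm g)\<^sup>2) \<le> s * (\<beta> * (norm g)\<^sup>2)"
      using \<eta>_\<beta> s_gt by (intro mult_left_mono mult_right_mono) auto
    with mono have "inner g v + s * (\<eta> * (1 + \<tau>) * (norm g)\<^sup>2) \<le> s * inner g w" by linarith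
    then have 1: "\<delta> t * (inner g v + s * (\<eta> * (1 + \<tau>) * (norm g)\<^sup>2)) \<le> \<delta> t * (s * inner g w)"
      using \<delta>0 by (intro mult_left_mono)
    have \<omega>0: "0 \<le> s * \<omega>" using ts s_gt \<gamma>_pos \<eta>_pos by (simp add: \<omega>_def)
    have "s * \<omega> / 2 * ((norm g)\<^sup>2 - (norm e)\<^sup>2) \<le> s * \<omega> / 2 * (norm g)\<^sup>2"
      using \<omega>0 by (intro mult_left_mono) auto
    also have "\<dots> \<le> (s * \<eta> * 3 / 4) / 2 * (norm g)\<^sup>2"
    proof -
      have "3 / 4 * \<eta> \<le> s * \<eta> * 3 / 4" using s_gt \<eta>_pos by simp
      then show ?thesis using \<omega>_le by (intro mult_right_mono divide_right_mono) auto
    qed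
    finally have 2: "\<delta> t * (s * \<omega> / 2 * ((norm g)\<^sup>2 - (norm e)\<^sup>2)) \<le> \<delta> t * (s * \<eta> * 3 / 8 * (norm g)\<^sup>2)"
      using \<delta>0 by (intro mult_left_mono) auto
    from 1 2 show ?thesis by linarith
  qed
  also have "\<dots> = c t * (norm w)\<^sup>2 - \<delta> t * inner g v
     - s * \<delta> t * \<eta> * (5 / 8 + \<tau>) * (norm g)\<^sup>2 + s * \<delta> t * inner e w'"
    by (simp add: algebra_simps)
  finally show ?thesis .
qed

lemma \<mu>_mult: "3 * s + \<tau> \<le> t \<Longrightarrow> \<mu> t * t = t + h"
  using s_gt \<tau>_ge by (simp add: \<mu>_def field_simps)

text \<open>Here \<open>p\<close> is the displacement of \<open>y\<close>, \<open>g - e\<close> the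
  delayed estimator and \<open>u\<close> the component part of the cocoercivity bound. The step
  identity is multiplied by \<open>\<mu> t\<close> because \<open>\<mu> t * t = t + h\<close> is the
  weight that belongs to \<open>t + 1\<close>.\<close>

lemma lyap_step:
  fixes g g' e v v' w w' p :: "'v::real_inner"
  assumes t: "3 * s + \<tau> \<le> t"
    and v: "t *\<^sub>R p = v - (\<eta> * t / 2 + \<gamma> * (\<eta> * t / (2 * (t - s)))) *\<^sub>R (g - e)"
    and v': "v' = (t - s) *\<^sub>R p + (\<eta> * t / 2) *\<^sub>R (g - e)"
    and w': "w' = w - (\<gamma> / s * (\<eta> * t / (2 * (t - s)))) *\<^sub>R (g - e)"
    and mono: "s * inner g w - inner g v \<ge> s * (\<beta> * (norm g)\<^sup>2)"
    and coco: "inner (g' - g) p \<ge> \<beta> * (norm (g' - g))\<^sup>2 + u"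
  shows "lyap (t + 1) g' v' w' \<le> lyap t g v w - \<eta> / 2 * (s - \<gamma> - 1) * t * (norm g)\<^sup>2
     + delay_weight t * ((norm e)\<^sup>2 / \<tau>) - \<mu> t * t * (t - s) * u"
proof -
  have ts: "0 < t" "0 < t - s" "s / t \<le> 1 / 3" using t s_gt \<tau>_ge by (auto simp: field_simps)
  have \<mu>0: "1 \<le> \<mu> t" using \<mu>_ge[OF t] .
  note \<mu>t = \<mu>_mult[OF t]
  have sg: "0 < s - \<gamma>" using s_gt \<gamma>_le by linarith
  define P where "P = - ((t - s) * inner g v) - \<eta> * t\<^sup>2 / 2 * inner g' (g - e)
     + \<eta> * t / 2 * (t - s + \<gamma>) * inner g (g - e) - t * (t - s) * inner (g' - g) p"
  have P_eq: "- (t * inner g' v') = P"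
    using afp_step_identity[OF _ _ v v', of g' g] ts by (simp add: P_def)
  \<comment> \<open>With this weight and \<open>t \<le> 3 / 2 * (t - s)\<close>, the square of
    \<open>g' - g\<close> costs \<open>\<eta> * (3 / 8 + \<tau>)\<close>, which stays below
    \<open>\<beta>\<close>.\<close>
  have a1: "2 * inner (g' - g) e \<le> 8 / 3 * \<tau> * (norm (g' - g))\<^sup>2 + 3 / 8 / \<tau> * (norm e)\<^sup>2"
    using \<tau>_ge by (intro young_inner) auto
  \<comment> \<open>The factor \<open>1 / t\<close> leaves a multiple of the square of
    \<open>g\<close> that does not grow with \<open>t\<close>, while the error enters at the order
    of \<open>t\<^sup>2 / \<tau>\<close>, as in \<open>a1\<close>.\<close>
  have a2: "2 * inner g e \<le> (2 / 7 * (s - \<gamma>) * \<tau> / t) * (norm g)\<^sup>2 + (7 / 2 / (s - \<gamma>) * t / \<tau>) * (norm e)\<^sup>2"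
    using \<tau>_ge ts sg by (intro young_inner) (auto simp: field_simps)
  \<comment> \<open>The weight of \<open>w'\<close> is precisely the drop of \<open>c\<close>;
    \<open>\<kappa>_drop\<close> supplies the discriminant condition.\<close>
  have a3: "s * \<delta> t * inner w' e \<le> (c t - c (t + 1)) * (norm w')\<^sup>2
      + (\<mu> t * t\<^sup>2 * (\<eta> * (s - \<gamma>)) / \<tau>) * (norm e)\<^sup>2"
  proof (rule young_inner)
    have cc: "c t - c (t + 1) = s\<^sup>2 / (\<gamma> * \<eta>) * (\<kappa> t - \<kappa> (t + 1))"
      by (simp add: c_def diff_divide_distrib right_diff_distrib)
    have K: "\<gamma> * (\<delta> t)\<^sup>2 * \<tau> \<le> (4 * (s - \<gamma>) * \<mu> t * t\<^sup>2) * (\<kappa> t - \<kappa> (t + 1))"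
      using \<kappa>_drop[OF t] .
    have "0 \<le> \<gamma> * (\<delta> t)\<^sup>2 * \<tau>" using \<gamma>_pos \<tau>_ge by simp
    with K have "0 \<le> (4 * (s - \<gamma>) * \<mu> t * t\<^sup>2) * (\<kappa> t - \<kappa> (t + 1))" by linarith
    moreover have "0 < 4 * (s - \<gamma>) * \<mu> t * t\<^sup>2" using sg ts \<mu>0 by simp
    ultimately have "0 \<le> \<kappa> t - \<kappa> (t + 1)" by (simp only: zero_le_mult_iff) linarith
    then show "0 \<le> c t - c (t + 1)" using \<gamma>_pos \<eta>_pos by (simp add: cc)
    show "0 < \<mu> t * t\<^sup>2 * (\<eta> * (s - \<gamma>)) / \<tau>" using \<mu>0 ts sg \<eta>_pos \<tau>_ge by simp
    have "(s * \<delta> t)\<^sup>2 = s\<^sup>2 / (\<gamma> * \<tau>) * (\<gamma> * (\<delta> t)\<^sup>2 * \<tau>)"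
      using \<gamma>_pos \<tau>_ge by (simp add: power2_eq_square)
    also have "\<dots> \<le> s\<^sup>2 / (\<gamma> * \<tau>) * ((4 * (s - \<gamma>) * \<mu> t * t\<^sup>2) * (\<kappa> t - \<kappa> (t + 1)))"
      using K \<gamma>_pos \<tau>_ge by (intro mult_left_mono) auto
    also have "\<dots> = 4 * (c t - c (t + 1)) * (\<mu> t * t\<^sup>2 * (\<eta> * (s - \<gamma>)) / \<tau>)"
      using \<gamma>_pos \<tau>_ge \<eta>_pos by (simp add: cc)
    finally show "(s * \<delta> t)\<^sup>2 \<le> 4 * (c t - c (t + 1)) * (\<mu> t * t\<^sup>2 * (\<eta> * (s - \<gamma>)) / \<tau>)" .
  qed
  have Z: "c (t + 1) * (norm w')\<^sup>2 \<le> c t * (norm w)\<^sup>2 - \<delta> t * inner g v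
     - s * \<delta> t * \<eta> * (5 / 8 + \<tau>) * (norm g)\<^sup>2 + (\<mu> t * t\<^sup>2 * (\<eta> * (s - \<gamma>)) / \<tau>) * (norm e)\<^sup>2"
    using z_step[OF t w' mono] a3 by (simp add: inner_commute algebra_simps)
  have "P = - ((t - s) * inner g v)
      + \<eta> * t\<^sup>2 / 4 * ((norm (g' - g))\<^sup>2 - (norm g')\<^sup>2 - (norm g)\<^sup>2 + 2 * inner (g' - g) e)
      + \<eta> * t / 2 * (t - s + \<gamma>) * (norm g)\<^sup>2 + \<eta> * t / 4 * (s - \<gamma>) * (2 * inner g e)
      - t * (t - s) * inner (g' - g) p"
    unfolding P_def power2_norm_eq_inner
    by (simp add: inner_diff_left inner_diff_right inner_commute field_simps power2_eq_square)
  also have "\<dots> \<le> - ((t - s) * inner g v)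
      + \<eta> * t\<^sup>2 / 4 * ((norm (g' - g))\<^sup>2 - (norm g')\<^sup>2 - (norm g)\<^sup>2
          + (8 / 3 * \<tau> * (norm (g' - g))\<^sup>2 + 3 / 8 / \<tau> * (norm e)\<^sup>2))
      + \<eta> * t / 2 * (t - s + \<gamma>) * (norm g)\<^sup>2
      + \<eta> * t / 4 * (s - \<gamma>) * ((2 / 7 * (s - \<gamma>) * \<tau> / t) * (norm g)\<^sup>2 + (7 / 2 / (s - \<gamma>) * t / \<tau>) * (norm e)\<^sup>2)
      - t * (t - s) * (\<beta> * (norm (g' - g))\<^sup>2 + u)"
    using a1 a2 coco ts sg \<eta>_pos
    by (intro add_mono diff_mono mult_left_mono order_refl) auto
  also have "\<dots> = - ((t - s) * inner g v) - \<eta> / 4 * t\<^sup>2 * (norm g')\<^sup>2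
      + \<eta> / 4 * (t\<^sup>2 - 2 * t * (s - \<gamma>) + 2 / 7 * (s - \<gamma>)\<^sup>2 * \<tau>) * (norm g)\<^sup>2
      + \<eta> / 4 * t\<^sup>2 * (31 / 8) * ((norm e)\<^sup>2 / \<tau>)
      - t * (t - s) * u
      - (t * (t - s) * \<beta> - \<eta> * t\<^sup>2 / 4 * (1 + 8 / 3 * \<tau>)) * (norm (g' - g))\<^sup>2"
    using ts sg \<tau>_ge by (simp add: field_simps power2_eq_square)
  also have "\<dots> \<le> - ((t - s) * inner g v) - \<eta> / 4 * t\<^sup>2 * (norm g')\<^sup>2
      + \<eta> / 4 * (t\<^sup>2 - 2 * t * (s - \<gamma>) + 2 / 7 * (s - \<gamma>)\<^sup>2 * \<tau>) * (norm g)\<^sup>2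
      + \<eta> / 4 * t\<^sup>2 * (31 / 8) * ((norm e)\<^sup>2 / \<tau>)
      - t * (t - s) * u"
  proof -
    have "\<eta> * t\<^sup>2 / 4 * (1 + 8 / 3 * \<tau>) = (t * (2 / 3 * t)) * (\<eta> * (3 / 8 + \<tau>))"
      by (simp add: field_simps power2_eq_square)
    also have "\<dots> \<le> (t * (t - s)) * (\<eta> * (1 + \<tau>))"
      using ts t \<tau>_ge \<eta>_pos by (intro mult_mono) auto
    also have "\<dots> \<le> t * (t - s) * \<beta>" using ts \<eta>_\<beta> by (intro mult_left_mono) auto
    finally have "0 \<le> (t * (t - s) * \<beta> - \<eta> * t\<^sup>2 / 4 * (1 + 8 / 3 * \<tau>)) * (norm (g' - g))\<^sup>2" by simp
    then show ?thesis by linarith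
  qed
  finally have PB: "P \<le> \<dots>" .
  have "- ((t + h) * inner g' v') = \<mu> t * P" by (simp flip: P_eq \<mu>t)
  also have "\<dots> \<le> \<mu> t * (- ((t - s) * inner g v) - \<eta> / 4 * t\<^sup>2 * (norm g')\<^sup>2
      + \<eta> / 4 * (t\<^sup>2 - 2 * t * (s - \<gamma>) + 2 / 7 * (s - \<gamma>)\<^sup>2 * \<tau>) * (norm g)\<^sup>2
      + \<eta> / 4 * t\<^sup>2 * (31 / 8) * ((norm e)\<^sup>2 / \<tau>)
      - t * (t - s) * u)"
    using PB \<mu>0 by (intro mult_left_mono) auto
  also have "\<dots> = - (\<mu> t * (t - s)) * inner g v - \<eta> / 4 * (\<mu> t * t) * t * (norm g')\<^sup>2
      + \<eta> / 4 * ((\<mu> t * t) * (t - 2 * (s - \<gamma>)) + 2 / 7 * (s - \<gamma>)\<^sup>2 * \<mu> t * \<tau>) * (norm g)\<^sup>2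
      + \<mu> t * t\<^sup>2 * (\<eta> / 4 * (31 / 8)) * ((norm e)\<^sup>2 / \<tau>)
      - \<mu> t * t * (t - s) * u"
    by (simp add: algebra_simps power2_eq_square)
  also have "\<dots> = - (\<mu> t * (t - s)) * inner g v - \<eta> / 4 * (t + h) * t * (norm g')\<^sup>2
      + \<eta> / 4 * ((t + h) * (t - 2 * (s - \<gamma>)) + 2 / 7 * (s - \<gamma>)\<^sup>2 * \<mu> t * \<tau>) * (norm g)\<^sup>2
      + \<mu> t * t\<^sup>2 * (\<eta> / 4 * (31 / 8)) * ((norm e)\<^sup>2 / \<tau>)
      - \<mu> t * t * (t - s) * u"
    unfolding \<mu>t ..
  finally have main: "- ((t + h) * inner g' v') \<le> \<dots>" .
  \<comment> \<open>Together with the term \<open>\<delta> t * inner g v\<close> of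
    \<open>z_step\<close> this restores the weight \<open>t - 1 + h\<close> of the old
    function.\<close>
  have coeff_v: "\<mu> t * (t - s) = t - 1 + h - \<delta> t"
    using ts by (simp add: \<mu>_def \<delta>_def field_simps)
  have coeff_g: "\<eta> / 4 * ((t + h) * (t - 2 * (s - \<gamma>)) + 2 / 7 * (s - \<gamma>)\<^sup>2 * \<mu> t * \<tau>) * (norm g)\<^sup>2
      - s * \<delta> t * \<eta> * (5 / 8 + \<tau>) * (norm g)\<^sup>2
     \<le> \<eta> / 4 * (t - 1) * (t - 1 + h) * (norm g)\<^sup>2 - \<eta> / 2 * (s - \<gamma> - 1) * t * (norm g)\<^sup>2"
  \<comment> \<open>The product \<open>(t - 1) * (t - 1 + h)\<close> exceeds
    \<open>(t + h) * (t - 2 * (s - \<gamma>))\<close> by \<open>2 * (s - \<gamma> - 1) * t\<close>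
    plus \<open>h * (2 * (s - \<gamma>) - 1) + 1\<close>. The linear part becomes the decrease, the
    constant part helps to pay for the delay.\<close>
  proof -
    have "\<eta> / 4 * ((t + h) * (t - 2 * (s - \<gamma>)) + 2 / 7 * (s - \<gamma>)\<^sup>2 * \<mu> t * \<tau>)
      \<le> \<eta> / 4 * ((t + h) * (t - 2 * (s - \<gamma>)) + (h * (2 * (s - \<gamma>) - 1) + 1 + 4 * s * \<delta> t * (5 / 8 + \<tau>)))"
      using residual_absorbs_delay[OF t] \<eta>_pos by (intro mult_left_mono add_left_mono) auto
    also have "\<dots> = \<eta> / 4 * (t - 1) * (t - 1 + h) - \<eta> / 2 * (s - \<gamma> - 1) * t + s * \<delta> t * \<eta> * (5 / 8 + \<tau>)"
      by (simp add: field_simps)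
    finally have "(\<eta> / 4 * ((t + h) * (t - 2 * (s - \<gamma>)) + 2 / 7 * (s - \<gamma>)\<^sup>2 * \<mu> t * \<tau>)) * (norm g)\<^sup>2
      \<le> (\<eta> / 4 * (t - 1) * (t - 1 + h) - \<eta> / 2 * (s - \<gamma> - 1) * t + s * \<delta> t * \<eta> * (5 / 8 + \<tau>)) * (norm g)\<^sup>2"
      by (intro mult_right_mono) auto
    then show ?thesis by (simp only: left_diff_distrib distrib_right)
  qed
  have dw: "delay_weight t * ((norm e)\<^sup>2 / \<tau>) = \<mu> t * t\<^sup>2 * (\<eta> / 4 * (31 / 8)) * ((norm e)\<^sup>2 / \<tau>)
      + (\<mu> t * t\<^sup>2 * (\<eta> * (s - \<gamma>)) / \<tau>) * (norm e)\<^sup>2"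
    by (simp add: delay_weight_def algebra_simps add_divide_distrib diff_divide_distrib)
  have "lyap (t + 1) g' v' w' = \<eta> / 4 * (t + h) * t * (norm g')\<^sup>2 - (t + h) * inner g' v' + c (t + 1) * (norm w')\<^sup>2"
    by (simp add: lyap_def mult_ac)
  moreover have "(\<mu> t * (t - s)) * inner g v = (t - 1 + h) * inner g v - \<delta> t * inner g v"
    unfolding coeff_v by (simp add: algebra_simps)
  ultimately show ?thesis
    unfolding lyap_def[of t] dw using main Z coeff_g by simp
qed

section \<open>Lower bound and initial value of the Lyapunov function\<close>

lemma one_minus_ratio: "2 / 3 \<le> 1 - \<gamma> / (s - 1)" "\<gamma> / (s - 1) \<le> 1 / 3"
  using s_gt s_ge by (auto simp: field_simps)

text \<open>Monotonicity trades the product of \<open>g\<close> and \<open>v\<close> for that of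
  \<open>g\<close> and \<open>w\<close>, which the distance term absorbs. Because of
  \<open>s - 1 \<le> \<kappa> t\<close> this costs the fraction \<open>\<gamma> / (s - 1)\<close> of
  the residual term.\<close>

lemma lyap_lower:
  fixes g v w :: "'v::real_inner"
  assumes t: "3 * s + \<tau> \<le> t"
    and mono: "s * inner g w - inner g v \<ge> s * (\<beta> * (norm g)\<^sup>2)"
  shows "(1 - \<gamma> / (s - 1)) * (\<eta> * (t - 1)\<^sup>2 / 4 * (norm g)\<^sup>2) \<le> lyap t g v w"
proof -
  define b where "b = t - 1 + h"
  have t1: "0 < t - 1" using t s_gt \<tau>_ge by linarith
  have b: "0 \<le> b" "t - 1 \<le> b" using h_nonneg t1 by (auto simp: b_def)
  have \<kappa>0: "s - 1 \<le> \<kappa> t" "0 < \<kappa> t" using \<kappa>_ge[OF t] s_gt by auto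
  have c0: "0 < c t" using \<kappa>0 s_gt \<gamma>_pos \<eta>_pos by (simp add: c_def)
  have y: "(b * s) * inner g w \<le> (\<gamma> * \<eta> * b\<^sup>2 / (4 * \<kappa> t)) * (norm g)\<^sup>2 + c t * (norm w)\<^sup>2"
    using \<kappa>0 \<gamma>_pos \<eta>_pos c0
    by (intro young_inner) (auto simp: c_def power2_eq_square field_simps)
  have "b * (s * (\<eta> * (1 + \<tau>) * (norm g)\<^sup>2)) \<le> b * (s * (\<beta> * (norm g)\<^sup>2))"
    using b s_gt \<eta>_\<beta> by (intro mult_left_mono mult_right_mono) auto
  also have "\<dots> \<le> b * (s * inner g w - inner g v)" using mono b by (intro mult_left_mono) auto
  finally have m: "b * inner g v \<le> b * s * inner g w - b * s * \<eta> * (1 + \<tau>) * (norm g)\<^sup>2"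
    by (simp add: algebra_simps)
  have "\<gamma> * \<eta> * b\<^sup>2 / (4 * \<kappa> t) \<le> \<gamma> * \<eta> * b\<^sup>2 / (4 * (s - 1))"
    using \<kappa>0 s_gt \<gamma>_pos \<eta>_pos by (intro divide_left_mono) auto
  also have "\<dots> = \<eta> / 4 * b * (\<gamma> / (s - 1) * (t - 1) + \<gamma> / (s - 1) * h)"
    unfolding distrib_left[symmetric] b_def[symmetric] by (simp add: power2_eq_square)
  also have "\<dots> \<le> \<eta> / 4 * b * (\<gamma> / (s - 1) * (t - 1) + 4 * s * (1 + \<tau>))"
  proof -
    \<comment> \<open>The contribution of \<open>h\<close> to the cost is covered by the
      cocoercivity term, which is \<open>4 * s * (1 + \<tau>)\<close> in units of
      \<open>\<eta> / 4 * b\<close>.\<close>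
    have "\<gamma> / (s - 1) * h \<le> 1 / 3 * h" using one_minus_ratio h_nonneg by (intro mult_right_mono) auto
    also have "\<dots> \<le> 4 * s * (1 + \<tau>)"
    proof -
      have "0 \<le> 4 * ((s - 1) * \<tau>) + 3 * s + 58 / 15 * \<tau> + 1" using s_gt \<tau>_ge by simp
      then show ?thesis by (simp add: h_def algebra_simps)
    qed
    finally show ?thesis using b \<eta>_pos by (intro mult_left_mono add_left_mono) auto
  qed
  finally have k: "\<gamma> * \<eta> * b\<^sup>2 / (4 * \<kappa> t) * (norm g)\<^sup>2
      \<le> \<eta> / 4 * b * (\<gamma> / (s - 1) * (t - 1) + 4 * s * (1 + \<tau>)) * (norm g)\<^sup>2"
    by (intro mult_right_mono) auto
  have ratio: "(1 - \<rho>) * (\<eta> / 4 * b * (t - 1) * (norm g)\<^sup>2)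
      = \<eta> / 4 * (t - 1) * b * (norm g)\<^sup>2 + b * s * \<eta> * (1 + \<tau>) * (norm g)\<^sup>2
      - \<eta> / 4 * b * (\<rho> * (t - 1) + 4 * s * (1 + \<tau>)) * (norm g)\<^sup>2" for \<rho>
    by (simp add: field_simps)
  have "(1 - \<gamma> / (s - 1)) * (\<eta> * (t - 1)\<^sup>2 / 4 * (norm g)\<^sup>2)
     = (1 - \<gamma> / (s - 1)) * (\<eta> / 4 * (t - 1) * (t - 1) * (norm g)\<^sup>2)"
    by (simp add: power2_eq_square)
  also have "\<dots> \<le> (1 - \<gamma> / (s - 1)) * (\<eta> / 4 * b * (t - 1) * (norm g)\<^sup>2)"
  proof -
    have "0 \<le> 1 - \<gamma> / (s - 1)" using one_minus_ratio by linarith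
    moreover have "\<eta> / 4 * (t - 1) * (t - 1) * (norm g)\<^sup>2 \<le> \<eta> / 4 * b * (t - 1) * (norm g)\<^sup>2"
      using b t1 \<eta>_pos by (intro mult_left_mono mult_right_mono) auto
    ultimately show ?thesis by (rule mult_left_mono[rotated])
  qed
  also have "\<dots> = \<eta> / 4 * (t - 1) * b * (norm g)\<^sup>2 + b * s * \<eta> * (1 + \<tau>) * (norm g)\<^sup>2
      - \<eta> / 4 * b * (\<gamma> / (s - 1) * (t - 1) + 4 * s * (1 + \<tau>)) * (norm g)\<^sup>2"
    by (rule ratio)
  also have "\<dots> \<le> lyap t g v w"
    using y m k unfolding lyap_def b_def[symmetric] by linarith
  finally show ?thesis .
qed

text \<open>The leading factor is the one in \<open>lyap_lower\<close>, so the two cancel later. The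
  assumption is the Lipschitz bound at the starting point; it moves the excess of the residual
  coefficient to the distance term.\<close>

lemma lyap_init:
  fixes g w :: "'v::real_inner"
  assumes "\<beta> * norm g \<le> norm w"
  shows "lyap (3 * s + \<tau>) g 0 w \<le> (1 - \<gamma> / (s - 1))
     * (\<eta> * (3 * s + \<tau> - 1)\<^sup>2 / 2 * (norm g)\<^sup>2 + 2 * s ^ 3 / (\<eta> * \<gamma>) * (norm w)\<^sup>2)"
proof -
  define q where "q = 1 - \<gamma> / (s - 1)"
  define a where "a = 3 * s + \<tau> - 1"
  have a0: "0 < a" using s_gt \<tau>_ge by (simp add: a_def)
  have a_le: "a \<le> 3 / 2 * s * (1 + \<tau>)"
  proof -
    have "0 \<le> (3 / 2 * s - 1) * (\<tau> - 1)" using s_gt \<tau>_ge by simp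
    then show ?thesis by (simp add: a_def field_simps)
  qed
  \<comment> \<open>This is the excess of the coefficient \<open>a + h\<close> over its target
    \<open>2 * q * a\<close>, in units of \<open>\<eta> / 4 * a\<close>.\<close>
  have ex: "a + h - 2 * q * a \<le> (s - 1 + 1 / 15) * (1 + \<tau>)"
  proof -
    have "4 / 3 * a \<le> 2 * q * a" using one_minus_ratio a0 by (intro mult_right_mono) (auto simp: q_def)
    then have "a + h - 2 * q * a \<le> h - a / 3" by linarith
    also have "\<dots> = 2 * (s - 1) + \<tau> / 15 - 2 / 3" by (simp add: h_def a_def field_simps)
    also have "\<dots> \<le> (s - 1 + 1 / 15) * (1 + \<tau>)"
    proof -
      have "0 \<le> (s - 1) * (\<tau> - 1) + 11 / 15" using s_gt \<tau>_ge by simp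
      then have "2 * (s - 1) + \<tau> / 15 - 2 / 3 \<le> (s - 1) + (s - 1) * \<tau> + 1 / 15 + \<tau> / 15"
        by (simp add: algebra_simps)
      also have "\<dots> = (s - 1 + 1 / 15) * (1 + \<tau>)" by (simp add: field_simps)
      finally show ?thesis .
    qed
    finally show ?thesis .
  qed
  have g_le: "(\<eta> * (1 + \<tau>))\<^sup>2 * (norm g)\<^sup>2 \<le> (norm w)\<^sup>2"
  proof -
    have "\<eta> * (1 + \<tau>) * norm g \<le> \<beta> * norm g" using \<eta>_\<beta> by (intro mult_right_mono) auto
    with assms have "\<eta> * (1 + \<tau>) * norm g \<le> norm w" by linarith
    then have "(\<eta> * (1 + \<tau>) * norm g)\<^sup>2 \<le> (norm w)\<^sup>2"
      using \<eta>_pos \<tau>_ge by (intro power_mono) auto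
    then show ?thesis by (simp add: power_mult_distrib)
  qed
  have "\<eta> / 4 * a * (a + h - 2 * q * a) * (norm g)\<^sup>2
     \<le> \<eta> / 4 * (3 / 2 * s * (1 + \<tau>)) * ((s - 1 + 1 / 15) * (1 + \<tau>)) * (norm g)\<^sup>2"
  proof -
    have "\<eta> / 4 * a * (a + h - 2 * q * a) \<le> \<eta> / 4 * a * ((s - 1 + 1 / 15) * (1 + \<tau>))"
      using ex a0 \<eta>_pos by (intro mult_left_mono) auto
    also have "\<dots> \<le> \<eta> / 4 * (3 / 2 * s * (1 + \<tau>)) * ((s - 1 + 1 / 15) * (1 + \<tau>))"
      using a_le \<eta>_pos s_gt \<tau>_ge by (intro mult_right_mono mult_left_mono) auto
    finally show ?thesis by (intro mult_right_mono) auto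
  qed
  also have "\<dots> = 3 / 8 * s * (s - 1 + 1 / 15) / \<eta> * ((\<eta> * (1 + \<tau>))\<^sup>2 * (norm g)\<^sup>2)"
    using \<eta>_pos by (simp add: power2_eq_square field_simps)
  also have "\<dots> \<le> 3 / 8 * s * (s - 1 + 1 / 15) / \<eta> * (norm w)\<^sup>2"
    using g_le s_gt \<eta>_pos by (intro mult_left_mono) auto
  finally have 1: "\<eta> / 4 * a * (a + h - 2 * q * a) * (norm g)\<^sup>2 \<le> \<dots>" .
  have "s / (\<gamma> * \<eta>) * (\<gamma> * (3 / 8 * (s - 1 + 1 / 15)) + s * \<kappa> (3 * s + \<tau>)) \<le> s / (\<gamma> * \<eta>) * (2 * s\<^sup>2 * q)"
    using initial_budget s_gt \<gamma>_pos \<eta>_pos by (intro mult_left_mono) (auto simp: q_def)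
  then have "(3 / 8 * s * (s - 1 + 1 / 15) / \<eta> + c (3 * s + \<tau>)) * (norm w)\<^sup>2
     \<le> q * (2 * s ^ 3 / (\<eta> * \<gamma>)) * (norm w)\<^sup>2"
    using \<gamma>_pos \<eta>_pos
    by (intro mult_right_mono) (auto simp: c_def field_simps power2_eq_square power3_eq_cube)
  with 1 have "\<eta> / 4 * a * (a + h - 2 * q * a) * (norm g)\<^sup>2 + c (3 * s + \<tau>) * (norm w)\<^sup>2
     \<le> q * (2 * s ^ 3 / (\<eta> * \<gamma>)) * (norm w)\<^sup>2"
    by (simp only: distrib_right)
  moreover have "lyap (3 * s + \<tau>) g 0 w = \<eta> / 4 * a * (a + h) * (norm g)\<^sup>2 + c (3 * s + \<tau>) * (norm w)\<^sup>2"
    by (simp add: lyap_def a_def)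
  moreover have "q * (\<eta> * a\<^sup>2 / 2 * (norm g)\<^sup>2 + B) = \<eta> / 4 * a * (a + h) * (norm g)\<^sup>2
     - \<eta> / 4 * a * (a + h - 2 * q * a) * (norm g)\<^sup>2 + q * B" for B
    by (simp add: field_simps power2_eq_square)
  ultimately show ?thesis
    unfolding q_def[symmetric] a_def[symmetric] by (simp add: mult.assoc)
qed

end

section \<open>Sequences and delayed sums\<close>

text \<open>Subtracting the partial sums of \<open>e\<close> gives a decreasing sequence that is
  bounded below, since these sums are bounded.\<close>

lemma quasi_decreasing_convergent:
  fixes a e :: "nat \<Rightarrow> real"
  assumes step: "\<And>k. a (Suc k) \<le> a k + e k" and "summable e" and "\<And>k. B \<le> a k"
  shows "convergent a"
proof -
  define f where "f k = a k - sum e {..<k}" for k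
  have lim: "(\<lambda>k. sum e {..<k}) \<longlonglongrightarrow> suminf e" using assms(2) by (rule summable_LIMSEQ)
  then have "bounded (range (\<lambda>k. sum e {..<k}))" by (rule convergent_imp_bounded)
  then obtain K where K: "\<And>k. \<bar>sum e {..<k}\<bar> \<le> K" by (auto simp: bounded_iff)
  have "decseq f" using step by (intro decseq_SucI) (simp add: f_def algebra_simps)
  moreover have "B - K \<le> f k" for k using assms(3)[of k] K[of k] by (simp add: f_def)
  ultimately have "convergent f" by (metis decseq_convergent convergent_def)
  then have "convergent (\<lambda>k. f k + sum e {..<k})"
    using lim by (intro convergent_add) (auto simp: convergent_def)
  then show ?thesis by (simp add: f_def)
qed

text \<open>With a positive limit the series would eventually dominate a multiple of the harmonic
  series.\<close>

lemma zero_limit_if_harmonically_summable: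
  fixes a :: "nat \<Rightarrow> real"
  assumes lim: "a \<longlonglongrightarrow> L" and nonneg: "\<And>k. 0 \<le> a k" and "0 < c"
    and summable: "summable (\<lambda>k. a k / (real k + c))"
  shows "L = 0"
proof (rule ccontr)
  assume "L \<noteq> 0"
  moreover have "0 \<le> L" using lim nonneg by (simp add: LIMSEQ_le_const)
  ultimately have L: "0 < L" by simp
  then have "\<forall>\<^sub>F k in sequentially. L / 2 < a k"
    using lim by (intro order_tendstoD(1)) auto
  then obtain K where K: "\<And>k. K \<le> k \<Longrightarrow> L / 2 < a k" by (auto simp: eventually_sequentially)
  \<comment> \<open>The factor \<open>1 + c\<close> compares \<open>real k + c\<close> with
    \<open>real (Suc k)\<close>, and \<open>2 / L\<close> compensates the eventual lower bound
    \<open>L / 2\<close>.\<close>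
  have "summable (\<lambda>k. 2 * (1 + c) / L * (a k / (real k + c)))"
    using summable by (rule summable_mult)
  then have "summable (\<lambda>k. inverse (of_nat (Suc k)) :: real)"
  proof (rule summable_comparison_test_ev[rotated])
    show "\<forall>\<^sub>F k in sequentially. norm (inverse (of_nat (Suc k)) :: real) \<le> 2 * (1 + c) / L * (a k / (real k + c))"
    proof (rule eventually_sequentiallyI[of K])
      fix k assume "K \<le> k"
      have "inverse (real (Suc k)) \<le> (1 + c) / (real k + c)"
        using \<open>0 < c\<close> by (simp add: field_simps)
      also have "\<dots> = 2 * (1 + c) / L * (L / 2 / (real k + c))" using L \<open>0 < c\<close> by (simp add: divide_simps) (simp add: algebra_simps)
      also have "\<dots> \<le> 2 * (1 + c) / L * (a k / (real k + c))"
        using K[OF \<open>K \<le> k\<close>] L \<open>0 < c\<close> by (intro mult_left_mono divide_right_mono) auto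
      finally show "norm (inverse (of_nat (Suc k)) :: real) \<le> 2 * (1 + c) / L * (a k / (real k + c))"
        by simp
    qed
  qed
  then have "summable (\<lambda>k. inverse (of_nat k) :: real)" by (subst (asm) summable_Suc_iff)
  then show False using not_summable_harmonic[where 'a=real] by simp
qed

lemma norm_tendsto_0_of_square:
  fixes f :: "nat \<Rightarrow> 'a::real_normed_vector"
  assumes "a \<longlonglongrightarrow> (0::real)" "\<And>k. (norm (f k))\<^sup>2 \<le> a k"
  shows "f \<longlonglongrightarrow> 0"
proof -
  have "(\<lambda>k. (norm (f k))\<^sup>2) \<longlonglongrightarrow> 0"
    by (rule Lim_null_comparison[OF _ assms(1)]) (simp add: assms(2))
  then have "(\<lambda>k. sqrt ((norm (f k))\<^sup>2)) \<longlonglongrightarrow> sqrt 0" by (rule tendsto_real_sqrt)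
  then show ?thesis by (simp add: tendsto_norm_zero_iff)
qed

text \<open>The index \<open>j\<close> lies in the window of \<open>k\<close> exactly if
  \<open>j < k\<close> and \<open>k \<le> j + T\<close>. The right side also counts those
  \<open>k\<close> that are not below \<open>N\<close>, hence only an inequality.\<close>

lemma sum_window_swap:
  fixes U W :: "nat \<Rightarrow> real"
  assumes "\<And>j. 0 \<le> U j" "\<And>k. 0 \<le> W k"
  shows "(\<Sum>k<N. W k * (\<Sum>j=k-T..<k. U j)) \<le> (\<Sum>j<N. U j * (\<Sum>i=1..T. W (j + i)))"
proof -
  have "(\<Sum>k<N. W k * (\<Sum>j=k-T..<k. U j)) = (\<Sum>k<N. \<Sum>j<N. if j < k \<and> k \<le> j + T then W k * U j else 0)"
  proof (rule sum.cong[OF refl])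
    fix k assume "k \<in> {..<N}"
    then have "{k-T..<k} = {j \<in> {..<N}. j < k \<and> k \<le> j + T}" by auto
    then show "W k * (\<Sum>j=k-T..<k. U j) = (\<Sum>j<N. if j < k \<and> k \<le> j + T then W k * U j else 0)"
      by (simp add: sum_distrib_left sum.inter_filter[symmetric])
  qed
  also have "\<dots> = (\<Sum>j<N. \<Sum>k<N. if j < k \<and> k \<le> j + T then W k * U j else 0)"
    by (rule sum.swap)
  also have "\<dots> \<le> (\<Sum>j<N. U j * (\<Sum>i=1..T. W (j + i)))"
  proof (rule sum_mono)
    fix j
    have "(\<Sum>k<N. if j < k \<and> k \<le> j + T then W k * U j else 0) = (\<Sum>k\<in>{k\<in>{..<N}. j < k \<and> k \<le> j + T}. W k * U j)"
      by (simp add: sum.inter_filter[symmetric])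
    also have "\<dots> \<le> (\<Sum>k\<in>{1+j..T+j}. W k * U j)"
      using assms by (intro sum_mono2) auto
    also have "\<dots> = (\<Sum>i=1..T. W (j + i) * U j)"
      by (subst sum.shift_bounds_cl_nat_ivl) (simp add: add.commute)
    also have "\<dots> = U j * (\<Sum>i=1..T. W (j + i))"
      by (simp add: sum_distrib_left mult.commute)
    finally show "(\<Sum>k<N. if j < k \<and> k \<le> j + T then W k * U j else 0) \<le> U j * (\<Sum>i=1..T. W (j + i))" .
  qed
  finally show ?thesis .
qed

text \<open>Telescoping and the Cauchy-Schwarz inequality. The window is widened from
  \<open>d\<close> to \<open>T\<close> so that one bound serves all delays; truncated subtraction
  agrees with the convention for negative indices.\<close>

lemma norm_delay_difference:
  fixes f :: "nat \<Rightarrow> 'v::real_normed_vector"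
  assumes "d \<le> T"
  shows "(norm (f k - f (k - d)))\<^sup>2 \<le> real T * (\<Sum>j=k-T..<k. (norm (f (Suc j) - f j))\<^sup>2)"
proof -
  have "f k - f (k - d) = (\<Sum>j=k-d..<k. f (Suc j) - f j)"
    by (simp add: sum_Suc_diff')
  then have "norm (f k - f (k - d)) \<le> (\<Sum>j=k-d..<k. norm (f (Suc j) - f j))"
    by (simp add: norm_sum)
  then have "(norm (f k - f (k - d)))\<^sup>2 \<le> (\<Sum>j=k-d..<k. norm (f (Suc j) - f j))\<^sup>2"
    by (intro power_mono) auto
  also have "\<dots> \<le> (\<Sum>j=k-d..<k. (norm (f (Suc j) - f j))\<^sup>2) * real (card {k-d..<k})"
    by (rule sum_squared_le_sum_of_squares)
  also have "\<dots> \<le> (\<Sum>j=k-T..<k. (norm (f (Suc j) - f j))\<^sup>2) * real T"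
    using assms by (intro mult_mono sum_mono2) (auto intro!: sum_nonneg)
  finally show ?thesis by (simp add: mult.commute)
qed

lemma norm_mean_squared:
  fixes a :: "nat \<Rightarrow> 'v::real_normed_vector"
  assumes "1 \<le> n"
  shows "(norm ((1 / real n) *\<^sub>R (\<Sum>i=1..n. a i)))\<^sup>2 \<le> 1 / real n * (\<Sum>i=1..n. (norm (a i))\<^sup>2)"
proof -
  have "(norm (\<Sum>i=1..n. a i))\<^sup>2 \<le> (\<Sum>i=1..n. norm (a i))\<^sup>2"
    by (intro power_mono norm_sum) auto
  also have "\<dots> \<le> (\<Sum>i=1..n. (norm (a i))\<^sup>2) * real (card {1..n})"
    by (rule sum_squared_le_sum_of_squares)
  finally show ?thesis
    using assms by (simp add: power_mult_distrib power2_eq_square field_simps)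
qed

context afp_params
begin

lemma \<beta>_pos: "0 < \<beta>"
proof -
  have "0 < \<eta> * (1 + \<tau>)" using \<eta>_pos \<tau>_ge by simp
  then show ?thesis using \<eta>_\<beta> by linarith
qed

lemma \<beta>'_pos: "0 < \<beta>'"
proof -
  have "0 < 7 * (1 + s - \<gamma>) * \<tau> * \<eta>" using \<eta>_pos \<tau>_ge s_gt \<gamma>_le by simp
  then show ?thesis using \<eta>_\<beta>' by linarith
qed

end

section \<open>A single path\<close>

locale afp_path = afp_params +
  fixes n :: nat and Gs :: "nat \<Rightarrow> 'v \<Rightarrow> 'v::euclidean_space" and G :: "'v \<Rightarrow> 'v"
    and d :: "nat \<Rightarrow> nat \<Rightarrow> nat" and y0 :: 'v and x y z :: "nat \<Rightarrow> 'v"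
  assumes n_ge: "1 \<le> n"
    and fsf: "finite_sum_form n Gs G"
    and coco: "finite_sum_cocoercive \<beta> \<beta>' n Gs G"
    and delays: "\<And>i k. i \<in> {1..n} \<Longrightarrow> real (d i k) \<le> \<tau>"
    and scheme: "afp_scheme s (t_par s \<tau>) (\<lambda>k. \<gamma>) (eta_par s \<tau> \<eta>) y0
           (delayed_estimator n Gs d y) x y z"
begin

abbreviation t :: "nat \<Rightarrow> real" where "t \<equiv> t_par s \<tau>"
abbreviation g :: "nat \<Rightarrow> 'v" where "g k \<equiv> G (y k)"

definition q :: "nat \<Rightarrow> 'v" where "q = delayed_estimator n Gs d y"
definition e :: "nat \<Rightarrow> 'v" where "e k = g k - q k"
definition v :: "nat \<Rightarrow> 'v" where "v k = s *\<^sub>R (z k - y k)"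
definition U :: "nat \<Rightarrow> real" where
  "U k = 1 / real n * (\<Sum>i=1..n. (norm (Gs i (y (Suc k)) - Gs i (y k)))\<^sup>2)"
text \<open>Delays are integers, so the floor of the real bound \<tau> is the right window length.
  Near the start the window is cut off at 0.\<close>

definition S :: "nat \<Rightarrow> real" where "S k = (\<Sum>j=k - nat \<lfloor>\<tau>\<rfloor>..<k. U j)"

lemma t_Suc: "t (Suc k) = t k + 1" by (simp add: t_par_def)
lemma t_ge: "3 * s + \<tau> \<le> t k" by (simp add: t_par_def)
lemma t_gt: "4 \<le> t k" "s < t k" using t_ge[of k] s_gt \<tau>_ge by auto
lemma T_le: "real (nat \<lfloor>\<tau>\<rfloor>) \<le> \<tau>" using \<tau>_ge by linarith
lemma U_nonneg: "0 \<le> U k" by (simp add: U_def sum_nonneg)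
lemma S_nonneg: "0 \<le> S k" by (simp add: S_def sum_nonneg U_nonneg)

lemma coco_dest:
  "\<beta> * (norm (G a - G b))\<^sup>2 + \<beta>' / real n * (\<Sum>i=1..n. (norm (Gs i a - Gs i b))\<^sup>2) \<le> inner (G a - G b) (a - b)"
  using coco by (auto simp: finite_sum_cocoercive_def)

lemma coco_G: "\<beta> * (norm (G a - G b))\<^sup>2 \<le> inner (G a - G b) (a - b)"
proof -
  have "0 \<le> \<beta>' / real n * (\<Sum>i=1..n. (norm (Gs i a - Gs i b))\<^sup>2)"
    using \<beta>'_pos by (simp add: sum_nonneg)
  then show ?thesis using coco_dest[of a b] by linarith
qed

lemma lipschitz_G: "\<beta> * norm (G a - G b) \<le> norm (a - b)"
proof -
  have "norm (G a - G b) * (\<beta> * norm (G a - G b)) \<le> norm (G a - G b) * norm (a - b)"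
    using coco_G[of a b] Cauchy_Schwarz_ineq2[of "G a - G b" "a - b"]
    by (simp add: power2_eq_square mult_ac)
  then show ?thesis by (cases "norm (G a - G b) = 0") (auto simp: mult_le_cancel_left)
qed

lemma continuous_G: "continuous_on UNIV G"
proof -
  have "(1 / \<beta>)-lipschitz_on UNIV G"
    using lipschitz_G \<beta>_pos by (intro lipschitz_onI) (auto simp: dist_norm field_simps)
  then show ?thesis by (rule lipschitz_on_continuous_on)
qed

text \<open>The error is a mean of component differences. Convexity of the square over the
  components is used first and telescoping second, so that the increments combine to
  \<open>U\<close>.\<close>

lemma e_bound: "(norm (e k))\<^sup>2 \<le> \<tau> * S k"
proof -
  let ?T = "nat \<lfloor>\<tau>\<rfloor>"
  have "e k = (1 / real n) *\<^sub>R (\<Sum>i=1..n. Gs i (y k) - Gs i (y (k - d i k)))"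
    using fsf by (simp add: e_def q_def delayed_estimator_def finite_sum_form_def sum_subtractf scaleR_diff_right)
  then have "(norm (e k))\<^sup>2 \<le> 1 / real n * (\<Sum>i=1..n. (norm (Gs i (y k) - Gs i (y (k - d i k))))\<^sup>2)"
    using norm_mean_squared[OF n_ge] by simp
  also have "\<dots> \<le> 1 / real n * (\<Sum>i=1..n. real ?T * (\<Sum>j=k-?T..<k. (norm (Gs i (y (Suc j)) - Gs i (y j)))\<^sup>2))"
  proof (intro mult_left_mono sum_mono)
    fix i assume "i \<in> {1..n}"
    then have "d i k \<le> ?T" using delays[of i k] \<tau>_ge by linarith
    then show "(norm (Gs i (y k) - Gs i (y (k - d i k))))\<^sup>2 \<le> real ?T * (\<Sum>j=k-?T..<k. (norm (Gs i (y (Suc j)) - Gs i (y j)))\<^sup>2)"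
      by (rule norm_delay_difference[where f = "\<lambda>j. Gs i (y j)"])
  qed auto
  also have "\<dots> = real ?T * S k"
    unfolding S_def U_def sum_distrib_left by (subst sum.swap) (simp add: mult_ac)
  also have "\<dots> \<le> \<tau> * S k" using T_le S_nonneg by (intro mult_right_mono) auto
  finally show ?thesis .
qed

section \<open>The scheme in terms of displacements and of \<open>v\<close>\<close>

abbreviation step_size :: "nat \<Rightarrow> real" where "step_size k \<equiv> \<eta> * t k / (2 * (t k - s))"

lemma step_size_bounds: "0 < step_size k" "step_size k \<le> \<eta>"
proof -
  show "0 < step_size k" using t_gt[of k] \<eta>_pos s_gt by simp
  have "t k \<le> 2 * (t k - s)" using t_ge[of k] s_gt \<tau>_ge by simp
  then have "\<eta> * t k \<le> \<eta> * (2 * (t k - s))" using \<eta>_pos by (intro mult_left_mono) auto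
  then show "step_size k \<le> \<eta>" using t_gt[of k] by (simp add: pos_divide_le_eq)
qed

lemma init: "y 0 = y0" "z 0 = y0"
  using scheme by (auto simp: afp_scheme_def)

lemma x_Suc: "x (Suc k) = y k - step_size k *\<^sub>R q k"
  using scheme by (simp add: afp_scheme_def eta_par_def q_def)

lemma z_Suc: "z (Suc k) = z k - (\<gamma> / s * step_size k) *\<^sub>R q k"
  using scheme by (simp add: afp_scheme_def eta_par_def q_def)

lemma y_Suc: "t k *\<^sub>R y (Suc k) = (t k - s) *\<^sub>R x (Suc k) + s *\<^sub>R z (Suc k)"
proof -
  have "y (Suc k) = ((t k - s) / t k) *\<^sub>R x (Suc k) + (s / t k) *\<^sub>R z (Suc k)"
    using scheme by (simp add: afp_scheme_def)
  then show ?thesis using t_gt[of k] by (simp add: scaleR_add_right)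
qed

lemma half_step: "(t k - s) * step_size k = \<eta> * t k / 2"
  using t_gt[of k] by (simp add: field_simps)

lemma displacement: "t k *\<^sub>R (y (Suc k) - y k) = v k - (\<eta> * t k / 2 + \<gamma> * step_size k) *\<^sub>R q k"
proof -
  have "t k *\<^sub>R (y (Suc k) - y k) = (t k - s) *\<^sub>R (y k - step_size k *\<^sub>R q k)
      + s *\<^sub>R (z k - (\<gamma> / s * step_size k) *\<^sub>R q k) - t k *\<^sub>R y k"
    by (simp only: scaleR_diff_right[of "t k"] y_Suc x_Suc z_Suc)
  also have "\<dots> = v k - ((t k - s) * step_size k + s * (\<gamma> / s * step_size k)) *\<^sub>R q k"
    by (simp add: v_def scaleR_diff_right scaleR_diff_left scaleR_add_left)
  also have "s * (\<gamma> / s * step_size k) = \<gamma> * step_size k" using s_gt by simp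
  finally show ?thesis unfolding half_step .
qed

lemma v_Suc: "v (Suc k) = (t k - s) *\<^sub>R (y (Suc k) - y k) + (\<eta> * t k / 2) *\<^sub>R q k"
proof -
  have "v (Suc k) = t k *\<^sub>R y (Suc k) - (t k - s) *\<^sub>R x (Suc k) - s *\<^sub>R y (Suc k)"
    by (simp add: y_Suc v_def scaleR_diff_right)
  also have "\<dots> = (t k - s) *\<^sub>R (y (Suc k) - y k) + ((t k - s) * step_size k) *\<^sub>R q k"
    unfolding x_Suc by (simp add: scaleR_diff_right scaleR_diff_left)
  finally show ?thesis unfolding half_step .
qed

text \<open>The displacement is eliminated. The coefficient of \<open>q k\<close> collapses to
  \<open>\<eta> * (s - \<gamma>) / 2\<close>, written so that the weights \<open>1 - s / t k\<close>
  and \<open>s / t k\<close> display a convex combination.\<close>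

lemma v_recursion: "v (Suc k) = (1 - s / t k) *\<^sub>R v k + (s / t k) *\<^sub>R ((\<eta> * (s - \<gamma>) / (2 * s) * t k) *\<^sub>R q k)"
proof -
  have tk: "t k \<noteq> 0" "t k - s \<noteq> 0" using t_gt[of k] by auto
  have "v (Suc k) = ((t k - s) / t k) *\<^sub>R (t k *\<^sub>R (y (Suc k) - y k)) + (\<eta> * t k / 2) *\<^sub>R q k"
    unfolding v_Suc using tk by simp
  also have "\<dots> = ((t k - s) / t k) *\<^sub>R v k
      + (\<eta> * t k / 2 - (t k - s) / t k * (\<eta> * t k / 2 + \<gamma> * step_size k)) *\<^sub>R q k"
    unfolding displacement by (simp add: scaleR_diff_right scaleR_diff_left)
  also have "(t k - s) / t k = 1 - s / t k" using tk by (simp add: diff_divide_distrib)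
  also have "\<eta> * t k / 2 - (1 - s / t k) * (\<eta> * t k / 2 + \<gamma> * step_size k)
      = s / t k * (\<eta> * (s - \<gamma>) / (2 * s) * t k)"
    using tk s_gt by (simp add: divide_simps) (simp add: algebra_simps)
  finally show ?thesis by simp
qed

section \<open>The Lyapunov function along the path\<close>

definition E :: "'v \<Rightarrow> nat \<Rightarrow> real" where
  "E xs k = lyap (t k) (g k) (v k) (z k - xs)"

text \<open>Cocoercivity between \<open>y k\<close> and the zero, with
  \<open>s *\<^sub>R (y k - xs)\<close> written as
  \<open>s *\<^sub>R (z k - xs) - v k\<close>.\<close>

lemma mono_at_zero:
  assumes "xs \<in> zer G"
  shows "s * (\<beta> * (norm (g k))\<^sup>2) \<le> s * inner (g k) (z k - xs) - inner (g k) (v k)"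
proof -
  have "\<beta> * (norm (g k))\<^sup>2 \<le> inner (g k) (y k - xs)"
    using coco_G[of "y k" xs] assms by (simp add: zer_def)
  then have "s * (\<beta> * (norm (g k))\<^sup>2) \<le> s * inner (g k) (y k - xs)"
    using s_gt by (intro mult_left_mono) auto
  also have "\<dots> = s * inner (g k) (z k - xs) - inner (g k) (v k)"
    by (simp add: v_def inner_diff_right algebra_simps)
  finally show ?thesis .
qed

lemma delay_weight_nonneg: "0 \<le> delay_weight (t k)"
  using \<mu>_ge[OF t_ge, of k] \<eta>_pos s_gt \<gamma>_le by (simp add: delay_weight_def)

lemma E_step:
  assumes "xs \<in> zer G"
  shows "E xs (Suc k) \<le> E xs k - \<eta> / 2 * (s - \<gamma> - 1) * t k * (norm (g k))\<^sup>2
     + delay_weight (t k) * S k - \<mu> (t k) * t k * (t k - s) * (\<beta>' * U k)"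
proof -
  have q: "q k = g k - e k" by (simp add: e_def)
  have "E xs (Suc k) \<le> E xs k - \<eta> / 2 * (s - \<gamma> - 1) * t k * (norm (g k))\<^sup>2
     + delay_weight (t k) * ((norm (e k))\<^sup>2 / \<tau>) - \<mu> (t k) * t k * (t k - s) * (\<beta>' * U k)"
    unfolding E_def t_Suc
  proof (rule lyap_step[OF t_ge displacement[of k, unfolded q] v_Suc[of k, unfolded q] _ mono_at_zero[OF assms]])
    show "z (Suc k) - xs = z k - xs - (\<gamma> / s * step_size k) *\<^sub>R (g k - e k)"
      by (simp add: z_Suc q)
    show "\<beta> * (norm (g (Suc k) - g k))\<^sup>2 + \<beta>' * U k \<le> inner (g (Suc k) - g k) (y (Suc k) - y k)"
      using coco_dest[of "y (Suc k)" "y k"] by (simp add: U_def)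
  qed
  moreover have "(norm (e k))\<^sup>2 / \<tau> \<le> S k"
    using e_bound[of k] \<tau>_ge by (simp add: pos_divide_le_eq mult.commute)
  then have "delay_weight (t k) * ((norm (e k))\<^sup>2 / \<tau>) \<le> delay_weight (t k) * S k"
    using delay_weight_nonneg by (intro mult_left_mono)
  ultimately show ?thesis by linarith
qed

lemma t_shift: "t (j + i) = t j + real i" by (simp add: t_par_def)

lemma t_window: "(\<Sum>i=1..nat \<lfloor>\<tau>\<rfloor>. (t (j + i))\<^sup>2) \<le> 7 / 3 * \<tau> * t j * (t j - s)"
  using window_sum[OF t_ge T_le, of j] by (simp add: t_shift)

text \<open>The left side is the total charge that the increment \<open>U j\<close> receives from
  later steps, and the right side stays strictly below what cocoercivity offers at \<open>j\<close>.
  The margin is \<open>7 / 3 * \<tau> * (\<eta> / 4) * (1 / 8)\<close>.\<close>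

lemma delay_weight_window:
  "(\<Sum>i=1..nat \<lfloor>\<tau>\<rfloor>. delay_weight (t (j + i))) \<le> \<mu> (t j) * t j * (t j - s) * (\<beta>' - 7 / 96 * \<tau> * \<eta>)"
proof -
  let ?\<Phi> = "\<eta> / 4 * (31 / 8 + 4 * (s - \<gamma>))"
  have \<Phi>0: "0 \<le> ?\<Phi>" using \<eta>_pos s_gt \<gamma>_le by simp
  have \<mu>0: "0 \<le> \<mu> (t j)" using \<mu>_ge[OF t_ge, of j] by simp
  have "(\<Sum>i=1..nat \<lfloor>\<tau>\<rfloor>. delay_weight (t (j + i))) \<le> (\<Sum>i=1..nat \<lfloor>\<tau>\<rfloor>. \<mu> (t j) * (t (j + i))\<^sup>2 * ?\<Phi>)"
    unfolding delay_weight_def using \<Phi>0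
    by (intro sum_mono mult_right_mono \<mu>_antimono[OF t_ge]) (auto simp: t_shift)
  also have "\<dots> = \<mu> (t j) * ?\<Phi> * (\<Sum>i=1..nat \<lfloor>\<tau>\<rfloor>. (t (j + i))\<^sup>2)"
    unfolding sum_distrib_left by (intro sum.cong) auto
  also have "\<dots> \<le> \<mu> (t j) * ?\<Phi> * (7 / 3 * \<tau> * t j * (t j - s))"
    using t_window \<mu>0 \<Phi>0 by (intro mult_left_mono) auto
  also have "\<dots> = (\<mu> (t j) * t j * (t j - s)) * (7 * (1 + s - \<gamma>) * \<tau> * \<eta> / 3 - 7 / 96 * \<tau> * \<eta>)"
    by (simp add: field_simps)
  also have "\<dots> \<le> (\<mu> (t j) * t j * (t j - s)) * (\<beta>' - 7 / 96 * \<tau> * \<eta>)"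
    using \<eta>_\<beta>' \<mu>0 t_gt[of j] by (intro mult_left_mono) auto
  finally show ?thesis .
qed

text \<open>A single step need not decrease \<open>E\<close>, since \<open>S k\<close> charges it
  for earlier increments. After summation the windows are exchanged and each increment pays for all
  its later charges; the margin keeps a positive multiple of the increments.\<close>

lemma E_sum:
  assumes "xs \<in> zer G"
  shows "E xs N + (\<Sum>k<N. \<eta> / 2 * (s - \<gamma> - 1) * t k * (norm (g k))\<^sup>2)
     + (\<Sum>k<N. 7 / 96 * \<tau> * \<eta> * (t k * (t k - s) * U k)) \<le> E xs 0"
proof -
  have "E xs N + (\<Sum>k<N. \<eta> / 2 * (s - \<gamma> - 1) * t k * (norm (g k))\<^sup>2)
      + (\<Sum>k<N. \<mu> (t k) * t k * (t k - s) * (\<beta>' * U k)) - (\<Sum>k<N. delay_weight (t k) * S k) \<le> E xs 0"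
  proof (induction N)
    case (Suc N)
    then show ?case using E_step[OF assms, of N] by simp
  qed simp
  moreover have "(\<Sum>k<N. delay_weight (t k) * S k)
      \<le> (\<Sum>j<N. U j * (\<Sum>i=1..nat \<lfloor>\<tau>\<rfloor>. delay_weight (t (j + i))))"
    unfolding S_def by (intro sum_window_swap U_nonneg delay_weight_nonneg)
  moreover have "\<dots> \<le> (\<Sum>j<N. U j * (\<mu> (t j) * t j * (t j - s) * (\<beta>' - 7 / 96 * \<tau> * \<eta>)))"
    by (intro sum_mono mult_left_mono delay_weight_window U_nonneg)
  moreover have "(\<Sum>j<N. U j * (\<mu> (t j) * t j * (t j - s) * (\<beta>' - 7 / 96 * \<tau> * \<eta>)))
     \<le> (\<Sum>k<N. \<mu> (t k) * t k * (t k - s) * (\<beta>' * U k)) - (\<Sum>k<N. 7 / 96 * \<tau> * \<eta> * (t k * (t k - s) * U k))"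
    unfolding sum_subtractf[symmetric]
  proof (rule sum_mono)
    fix k
    have "7 / 96 * \<tau> * \<eta> * (1 * (t k * (t k - s) * U k)) \<le> 7 / 96 * \<tau> * \<eta> * (\<mu> (t k) * (t k * (t k - s) * U k))"
      using \<mu>_ge[OF t_ge, of k] t_gt[of k] U_nonneg \<tau>_ge \<eta>_pos
      by (intro mult_left_mono mult_right_mono) auto
    then show "U k * (\<mu> (t k) * t k * (t k - s) * (\<beta>' - 7 / 96 * \<tau> * \<eta>))
      \<le> \<mu> (t k) * t k * (t k - s) * (\<beta>' * U k) - 7 / 96 * \<tau> * \<eta> * (t k * (t k - s) * U k)"
      by (simp add: algebra_simps)
  qed
  ultimately show ?thesis by linarith
qed

lemma slack_pos: "0 < s - \<gamma> - 1" using s_ge \<gamma>_pos by linarith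

lemma E_nonneg:
  assumes "xs \<in> zer G" shows "0 \<le> E xs k"
proof -
  have "0 \<le> (1 - \<gamma> / (s - 1)) * (\<eta> * (t k - 1)\<^sup>2 / 4 * (norm (g k))\<^sup>2)"
    using order_trans[OF _ one_minus_ratio(1), of 0] \<eta>_pos by (intro mult_nonneg_nonneg) auto
  also have "\<dots> \<le> E xs k" unfolding E_def by (rule lyap_lower[OF t_ge mono_at_zero[OF assms]])
  finally show ?thesis .
qed

lemma partial_sums_nonneg:
  "0 \<le> (\<Sum>k<N. \<eta> / 2 * (s - \<gamma> - 1) * t k * (norm (g k))\<^sup>2)"
  "0 \<le> (\<Sum>k<N. 7 / 96 * \<tau> * \<eta> * (t k * (t k - s) * U k))"
proof -
  have "0 \<le> \<eta> / 2 * (s - \<gamma> - 1) * t k * (norm (g k))\<^sup>2"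
    and "0 \<le> 7 / 96 * \<tau> * \<eta> * (t k * (t k - s) * U k)" for k
    using slack_pos t_gt[of k] \<eta>_pos \<tau>_ge U_nonneg by auto
  then show "0 \<le> (\<Sum>k<N. \<eta> / 2 * (s - \<gamma> - 1) * t k * (norm (g k))\<^sup>2)"
    and "0 \<le> (\<Sum>k<N. 7 / 96 * \<tau> * \<eta> * (t k * (t k - s) * U k))"
    by (simp_all only: sum_nonneg)
qed

lemma E_le_initial: "xs \<in> zer G \<Longrightarrow> E xs N \<le> E xs 0"
  using E_sum[of xs N] partial_sums_nonneg[of N] by linarith

lemma residual_bound:
  assumes "xs \<in> zer G"
  shows "\<eta> * (real k + 3 * s + \<tau> - 1)\<^sup>2 / 4 * (norm (g k))\<^sup>2 \<le> R0_sq \<gamma> s \<tau> \<eta> G y0 xs"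
proof -
  have "(1 - \<gamma> / (s - 1)) * (\<eta> * (t k - 1)\<^sup>2 / 4 * (norm (g k))\<^sup>2) \<le> E xs k"
    unfolding E_def by (rule lyap_lower[OF t_ge mono_at_zero[OF assms]])
  also have "\<dots> \<le> E xs 0" using assms by (rule E_le_initial)
  also have "\<dots> = lyap (3 * s + \<tau>) (G y0) 0 (y0 - xs)"
    by (simp add: E_def t_par_def v_def init)
  also have "\<dots> \<le> (1 - \<gamma> / (s - 1)) * R0_sq \<gamma> s \<tau> \<eta> G y0 xs"
    unfolding R0_sq_def using lipschitz_G[of y0 xs] assms by (intro lyap_init) (simp add: zer_def)
  finally have "(1 - \<gamma> / (s - 1)) * (\<eta> * (t k - 1)\<^sup>2 / 4 * (norm (g k))\<^sup>2)
     \<le> (1 - \<gamma> / (s - 1)) * R0_sq \<gamma> s \<tau> \<eta> G y0 xs" .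
  moreover have "0 < 1 - \<gamma> / (s - 1)" using one_minus_ratio(1) by linarith
  ultimately have "\<eta> * (t k - 1)\<^sup>2 / 4 * (norm (g k))\<^sup>2 \<le> R0_sq \<gamma> s \<tau> \<eta> G y0 xs"
    by (simp only: mult_le_cancel_left_pos)
  then show ?thesis by (simp add: t_par_def)
qed

section \<open>Summability of residuals, increments and estimators\<close>

lemma summable_residual:
  assumes "xs \<in> zer G" shows "summable (\<lambda>k. t k * (norm (g k))\<^sup>2)"
proof (rule bounded_imp_summable)
  let ?C = "\<eta> / 2 * (s - \<gamma> - 1)"
  have C: "0 < ?C" using slack_pos \<eta>_pos by simp
  show "0 \<le> t k * (norm (g k))\<^sup>2" for k using t_gt[of k] by simp
  fix N
  have "?C * (\<Sum>k\<le>N. t k * (norm (g k))\<^sup>2) = (\<Sum>k<Suc N. ?C * t k * (norm (g k))\<^sup>2)"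
    unfolding lessThan_Suc_atMost sum_distrib_left by (simp add: mult.assoc)
  also have "\<dots> \<le> E xs 0"
    using E_sum[OF assms, of "Suc N"] partial_sums_nonneg(2)[of "Suc N"] E_nonneg[OF assms, of "Suc N"] by linarith
  finally show "(\<Sum>k\<le>N. t k * (norm (g k))\<^sup>2) \<le> E xs 0 / ?C"
    using C by (simp only: pos_le_divide_eq mult.commute)
qed

lemma summable_window_energy:
  assumes "xs \<in> zer G" shows "summable (\<lambda>k. (t k)\<^sup>2 * S k)"
proof (rule bounded_imp_summable)
  show "0 \<le> (t k)\<^sup>2 * S k" for k using S_nonneg by simp
  fix N
  have "(\<Sum>k\<le>N. (t k)\<^sup>2 * S k) = (\<Sum>k<Suc N. (t k)\<^sup>2 * S k)"
    by (simp only: lessThan_Suc_atMost)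
  also have "\<dots> \<le> (\<Sum>j<Suc N. U j * (\<Sum>i=1..nat \<lfloor>\<tau>\<rfloor>. (t (j + i))\<^sup>2))"
    unfolding S_def by (intro sum_window_swap U_nonneg) auto
  also have "\<dots> \<le> (\<Sum>j<Suc N. U j * (7 / 3 * \<tau> * t j * (t j - s)))"
    by (intro sum_mono mult_left_mono t_window U_nonneg)
  \<comment> \<open>The factor \<open>32 / \<eta>\<close> turns the margin
    \<open>7 / 96 * \<tau> * \<eta>\<close> into the window constant
    \<open>7 / 3 * \<tau>\<close>.\<close>
  also have "\<dots> = 32 / \<eta> * (\<Sum>j<Suc N. 7 / 96 * \<tau> * \<eta> * (t j * (t j - s) * U j))"
    unfolding sum_distrib_left using \<eta>_pos by (intro sum.cong) auto
  also have "\<dots> \<le> 32 / \<eta> * E xs 0"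
    using E_sum[OF assms, of "Suc N"] partial_sums_nonneg(1)[of "Suc N"] E_nonneg[OF assms, of "Suc N"] \<eta>_pos
    by (intro mult_left_mono) auto
  finally show "(\<Sum>k\<le>N. (t k)\<^sup>2 * S k) \<le> 32 / \<eta> * E xs 0" .
qed

lemma summable_error:
  assumes "xs \<in> zer G" shows "summable (\<lambda>k. (t k)\<^sup>2 * (norm (e k))\<^sup>2)"
proof (rule summable_comparison_test'[where N = 0])
  show "summable (\<lambda>k. \<tau> * ((t k)\<^sup>2 * S k))"
    using summable_window_energy[OF assms] by (rule summable_mult)
  show "norm ((t k)\<^sup>2 * (norm (e k))\<^sup>2) \<le> \<tau> * ((t k)\<^sup>2 * S k)" for k
    using mult_left_mono[OF e_bound[of k], of "(t k)\<^sup>2"] by (simp add: mult_ac)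
qed

lemma summable_estimator:
  assumes "xs \<in> zer G" shows "summable (\<lambda>k. t k * (norm (q k))\<^sup>2)"
proof (rule summable_comparison_test'[where N = 0])
  show "summable (\<lambda>k. 2 * (t k * (norm (g k))\<^sup>2) + 2 * ((t k)\<^sup>2 * (norm (e k))\<^sup>2))"
    using summable_residual[OF assms] summable_error[OF assms] by (intro summable_add summable_mult)
  fix k
  have "norm (q k) \<le> norm (g k) + norm (e k)"
    using norm_triangle_ineq4[of "g k" "e k"] by (simp add: e_def)
  then have "(norm (q k))\<^sup>2 \<le> (norm (g k) + norm (e k))\<^sup>2" by (intro power_mono) auto
  also have "\<dots> \<le> 2 * (norm (g k))\<^sup>2 + 2 * (norm (e k))\<^sup>2"
    using sum_squares_bound[of "norm (g k)" "norm (e k)"] by (simp add: power2_sum)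
  finally have "t k * (norm (q k))\<^sup>2 \<le> t k * (2 * (norm (g k))\<^sup>2 + 2 * (norm (e k))\<^sup>2)"
    using t_gt[of k] by (intro mult_left_mono) auto
  moreover have "t k * (norm (e k))\<^sup>2 \<le> (t k)\<^sup>2 * (norm (e k))\<^sup>2"
    using t_gt[of k] by (intro mult_right_mono self_le_power) auto
  ultimately show "norm (t k * (norm (q k))\<^sup>2) \<le> 2 * (t k * (norm (g k))\<^sup>2) + 2 * ((t k)\<^sup>2 * (norm (e k))\<^sup>2)"
    using t_gt[of k] by (simp add: algebra_simps)
qed

lemma t_at_top: "filterlim t at_top sequentially"
proof -
  have "filterlim (\<lambda>k. (3 * s + \<tau>) + real k) at_top sequentially"
    by (rule filterlim_tendsto_add_at_top[OF tendsto_const filterlim_real_sequentially])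
  then show ?thesis
    by (rule filterlim_mono_eventually) (simp_all add: t_par_def)
qed

lemma summable_inverse_t_squared: "summable (\<lambda>k. 1 / (t k)\<^sup>2)"
proof (rule summable_comparison_test'[where N = 0])
  show "summable (\<lambda>k. inverse (real (Suc k) ^ 2))"
    using inverse_power_summable[of 2, where 'a = real] by (subst summable_Suc_iff) auto
  show "norm (1 / (t k)\<^sup>2) \<le> inverse (real (Suc k) ^ 2)" for k
  proof -
    have "real (Suc k) \<le> t k" using s_gt \<tau>_ge by (simp add: t_par_def)
    then have "(real (Suc k))\<^sup>2 \<le> (t k)\<^sup>2" by (intro power_mono) auto
    then show ?thesis by (simp add: inverse_eq_divide frac_le)
  qed
qed

text \<open>Convexity of the square applied to \<open>v_recursion\<close>. The loss proportional to
  \<open>1 / t k\<close> is kept because it yields \<open>summable_v\<close>.\<close>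

lemma v_energy_step:
  defines "C \<equiv> \<eta>\<^sup>2 * (s - \<gamma>)\<^sup>2 / (4 * s)"
  shows "(norm (v (Suc k)))\<^sup>2 \<le> (norm (v k))\<^sup>2 - s * ((norm (v k))\<^sup>2 / t k) + C * (t k * (norm (q k))\<^sup>2)"
proof -
  define a u where "a = s / t k" and "u = (\<eta> * (s - \<gamma>) / (2 * s) * t k) *\<^sub>R q k"
  have a: "0 \<le> a" "a \<le> 1" using t_gt[of k] s_gt by (auto simp: a_def)
  have "norm (v (Suc k)) \<le> (1 - a) * norm (v k) + a * norm u"
    unfolding v_recursion a_def[symmetric] u_def[symmetric]
    using a norm_triangle_ineq[of "(1 - a) *\<^sub>R v k" "a *\<^sub>R u"] by simp
  then have "(norm (v (Suc k)))\<^sup>2 \<le> ((1 - a) * norm (v k) + a * norm u)\<^sup>2"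
    by (intro power_mono) auto
  also have "\<dots> \<le> (1 - a) * (norm (v k))\<^sup>2 + a * (norm u)\<^sup>2"
  proof -
    have "0 \<le> a * (1 - a) * (norm (v k) - norm u)\<^sup>2" using a by simp
    then show ?thesis by (simp add: power2_eq_square algebra_simps)
  qed
  also have "a * (norm u)\<^sup>2 = C * (t k * (norm (q k))\<^sup>2)"
    using t_gt[of k] s_gt
    by (simp add: a_def u_def C_def power_mult_distrib power_divide) (simp add: power2_eq_square field_simps)
  finally show ?thesis by (simp add: a_def algebra_simps)
qed

lemma summable_v:
  assumes "xs \<in> zer G" shows "summable (\<lambda>k. (norm (v k))\<^sup>2 / t k)"
proof (rule bounded_imp_summable)
  define C where "C = \<eta>\<^sup>2 * (s - \<gamma>)\<^sup>2 / (4 * s)"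
  have C0: "0 \<le> C" using s_gt by (simp add: C_def)
  let ?Q = "\<lambda>k. t k * (norm (q k))\<^sup>2"
  have Q0: "0 \<le> ?Q k" for k using t_gt[of k] by simp
  show "0 \<le> (norm (v k))\<^sup>2 / t k" for k using t_gt[of k] by simp
  fix N
  have bound: "(norm (v M))\<^sup>2 + s * (\<Sum>k<M. (norm (v k))\<^sup>2 / t k) \<le> (norm (v 0))\<^sup>2 + C * (\<Sum>k<M. ?Q k)" for M
  proof (induction M)
    case (Suc M)
    then show ?case using v_energy_step[of M, folded C_def]
      unfolding sum.lessThan_Suc distrib_left by linarith
  qed simp
  have "0 \<le> (norm (v (Suc N)))\<^sup>2" by simp
  with bound[of "Suc N"] have "s * (\<Sum>k<Suc N. (norm (v k))\<^sup>2 / t k) \<le> (norm (v 0))\<^sup>2 + C * (\<Sum>k<Suc N. ?Q k)"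
    by linarith
  then have "s * (\<Sum>k\<le>N. (norm (v k))\<^sup>2 / t k) \<le> (norm (v 0))\<^sup>2 + C * (\<Sum>k<Suc N. ?Q k)"
    by (simp only: lessThan_Suc_atMost)
  also have "\<dots> \<le> (norm (v 0))\<^sup>2 + C * suminf ?Q"
    using summable_estimator[OF assms] Q0 C0 by (intro add_left_mono mult_left_mono sum_le_suminf) auto
  finally show "(\<Sum>k\<le>N. (norm (v k))\<^sup>2 / t k) \<le> ((norm (v 0))\<^sup>2 + C * suminf ?Q) / s"
    using s_gt by (simp add: pos_le_divide_eq mult.commute)
qed

lemma t_as_shift: "t k = real k + (3 * s + \<tau>)" by (simp add: t_par_def)

text \<open>The energy step makes the squared norm convergent, and its summability against
  \<open>1 / t k\<close> excludes a positive limit.\<close>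

lemma v_tendsto_0:
  assumes "xs \<in> zer G" shows "v \<longlonglongrightarrow> 0"
proof -
  define C where "C = \<eta>\<^sup>2 * (s - \<gamma>)\<^sup>2 / (4 * s)"
  have "convergent (\<lambda>k. (norm (v k))\<^sup>2)"
  proof (rule quasi_decreasing_convergent)
    show "summable (\<lambda>k. C * (t k * (norm (q k))\<^sup>2))"
      using summable_estimator[OF assms] by (rule summable_mult)
    show "(norm (v (Suc k)))\<^sup>2 \<le> (norm (v k))\<^sup>2 + C * (t k * (norm (q k))\<^sup>2)" for k
    proof -
      have "0 \<le> s * ((norm (v k))\<^sup>2 / t k)" using t_gt[of k] s_gt by simp
      then show ?thesis using v_energy_step[of k, folded C_def] by linarith
    qed
    show "0 \<le> (norm (v k))\<^sup>2" for k by simp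
  qed
  then obtain L where L: "(\<lambda>k. (norm (v k))\<^sup>2) \<longlonglongrightarrow> L" by (auto simp: convergent_def)
  have "L = 0"
  proof (rule zero_limit_if_harmonically_summable[OF L])
    show "summable (\<lambda>k. (norm (v k))\<^sup>2 / (real k + (3 * s + \<tau>)))"
      using summable_v[OF assms] by (simp only: t_as_shift)
  qed (use s_gt \<tau>_ge in auto)
  with L have "(\<lambda>k. sqrt ((norm (v k))\<^sup>2)) \<longlonglongrightarrow> sqrt 0" by (intro tendsto_real_sqrt) simp
  then show ?thesis by (simp add: tendsto_norm_zero_iff)
qed

lemma residual_bounded:
  assumes "xs \<in> zer G" obtains K where "0 \<le> K" "\<And>k. (t k - 1 + h) * norm (g k) \<le> K"
proof
  let ?R = "R0_sq \<gamma> s \<tau> \<eta> G y0 xs"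
  show "(t k - 1 + h) * norm (g k) \<le> 3 * sqrt (4 * ?R / \<eta>)" for k
  proof -
    have "((t k - 1) * norm (g k))\<^sup>2 = 4 / \<eta> * (\<eta> * (t k - 1)\<^sup>2 / 4 * (norm (g k))\<^sup>2)"
      using \<eta>_pos by (simp add: power_mult_distrib)
    also have "\<dots> \<le> 4 / \<eta> * ?R"
      using residual_bound[OF assms, of k] \<eta>_pos by (intro mult_left_mono) (auto simp: t_par_def)
    finally have "(t k - 1) * norm (g k) \<le> sqrt (4 * ?R / \<eta>)"
      by (intro real_le_rsqrt) simp
    \<comment> \<open>From \<open>h < t k\<close> and \<open>4 \<le> t k\<close> the weight is at
      most \<open>3 * (t k - 1)\<close>.\<close>
    moreover have "(t k - 1 + h) * norm (g k) \<le> (3 * (t k - 1)) * norm (g k)"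
      using h_less[OF t_ge, of k] t_gt[of k] by (intro mult_right_mono) auto
    moreover have "(3 * (t k - 1)) * norm (g k) = 3 * ((t k - 1) * norm (g k))" by (rule mult.assoc)
    ultimately show ?thesis by linarith
  qed
  have "0 \<le> ?R" using \<eta>_pos \<gamma>_pos s_gt by (simp add: R0_sq_def)
  then show "0 \<le> 3 * sqrt (4 * ?R / \<eta>)" using \<eta>_pos by simp
qed

section \<open>Boundedness and convergence of the iterates\<close>

lemma z_bounded:
  assumes "xs \<in> zer G" obtains B where "0 \<le> B" "\<And>k. norm (z k - xs) \<le> B"
proof -
  obtain K where K: "0 \<le> K" "\<And>k. (t k - 1 + h) * norm (g k) \<le> K"
    using residual_bounded[OF assms] by blast
  define c0 where "c0 = s\<^sup>2 * (s - 1) / (\<gamma> * \<eta>)"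
  have c0: "0 < c0" using s_gt \<gamma>_pos \<eta>_pos by (simp add: c0_def)
  have E0: "0 \<le> E xs 0" by (rule E_nonneg[OF assms])
  have "norm (z k - xs) \<le> max 1 ((E xs 0 + s * K) / c0)" for k
  proof (cases "norm (z k - xs) \<le> 1")
    case False
    define w where "w = norm (z k - xs)"
    have w: "1 < w" using False by (simp add: w_def)
    define b where "b = t k - 1 + h"
    have b: "0 \<le> b" using t_gt[of k] h_nonneg by (simp add: b_def)
    have "c0 \<le> c (t k)"
      unfolding c0_def c_def using \<kappa>_ge[OF t_ge, of k] \<gamma>_pos \<eta>_pos
      by (intro divide_right_mono mult_left_mono) auto
    then have 1: "c0 * w\<^sup>2 \<le> c (t k) * w\<^sup>2" by (intro mult_right_mono) auto
    have 2: "0 \<le> \<eta> / 4 * (t k - 1) * b * (norm (g k))\<^sup>2"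
      using t_gt[of k] b \<eta>_pos by simp
    have "0 \<le> s * (\<beta> * (norm (g k))\<^sup>2)" using s_gt \<beta>_pos by simp
    also have "\<dots> \<le> s * inner (g k) (z k - xs) - inner (g k) (v k)"
      by (rule mono_at_zero[OF assms])
    finally have "b * inner (g k) (v k) \<le> b * (s * inner (g k) (z k - xs))"
      using b by (intro mult_left_mono) auto
    also have "\<dots> \<le> b * (s * (norm (g k) * w))"
      using b s_gt norm_cauchy_schwarz[of "g k" "z k - xs"] unfolding w_def
      by (intro mult_left_mono) auto
    also have "\<dots> = (b * norm (g k)) * (s * w)" by simp
    also have "\<dots> \<le> K * (s * w)"
      using K(2)[of k] s_gt w by (intro mult_right_mono) (auto simp: b_def)
    finally have 3: "b * inner (g k) (v k) \<le> s * K * w" by (simp add: mult_ac)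
    have "c0 * w\<^sup>2 \<le> E xs k + s * K * w"
      using 1 2 3 unfolding E_def lyap_def b_def[symmetric] w_def by linarith
    \<comment> \<open>For \<open>1 < w\<close> the constant may carry a factor \<open>w\<close> as
      well; dividing by \<open>w\<close> then replaces the solution of a quadratic
      inequality.\<close>
    also have "\<dots> \<le> E xs 0 * w + s * K * w"
    proof -
      have "E xs k \<le> E xs 0 * 1" using E_le_initial[OF assms] by simp
      also have "\<dots> \<le> E xs 0 * w" using w E0 by (intro mult_left_mono) auto
      finally show ?thesis by simp
    qed
    finally have "(c0 * w) * w \<le> (E xs 0 + s * K) * w" by (simp add: power2_eq_square algebra_simps)
    then have "w * c0 \<le> E xs 0 + s * K" using w by (simp add: mult.commute)
    then show ?thesis using c0 unfolding w_def by (simp add: pos_le_divide_eq le_max_iff_disj)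
  qed simp
  then show ?thesis by (intro that[of "max 1 ((E xs 0 + s * K) / c0)"]) auto
qed

text \<open>In the expansion of the square, the product with \<open>g\<close> is bounded through
  \<open>v\<close> and the product with the error through the bound \<open>B\<close>. Splitting
  these with weights \<open>t k\<close> and \<open>(t k)\<^sup>2\<close> leaves only summable
  terms.\<close>

lemma distance_convergent:
  assumes "xs \<in> zer G" shows "convergent (\<lambda>k. (norm (z k - xs))\<^sup>2)"
proof -
  obtain B where B: "0 \<le> B" "\<And>k. norm (z k - xs) \<le> B" using z_bounded[OF assms] by blast
  define \<epsilon> where "\<epsilon> k = 2 * \<eta> * (t k * (norm (g k))\<^sup>2 + (norm (v k))\<^sup>2 / t k)
     + 2 * \<eta> * ((t k)\<^sup>2 * (norm (e k))\<^sup>2 + B\<^sup>2 * (1 / (t k)\<^sup>2)) + \<eta>\<^sup>2 * (t k * (norm (q k))\<^sup>2)" for k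
  show ?thesis
  proof (rule quasi_decreasing_convergent)
    show "summable \<epsilon>" unfolding \<epsilon>_def
      by (intro summable_add summable_mult summable_residual[OF assms] summable_v[OF assms]
          summable_error[OF assms] summable_inverse_t_squared summable_estimator[OF assms])
    show "0 \<le> (norm (z k - xs))\<^sup>2" for k by simp
    fix k
    define w \<omega> where "w = z k - xs" and "\<omega> = \<gamma> / s * step_size k"
    have tk: "1 \<le> t k" using t_gt[of k] by simp
    have \<omega>: "0 \<le> \<omega>" "\<omega> \<le> \<eta>"
    proof -
      show "0 \<le> \<omega>" using step_size_bounds(1)[of k] \<gamma>_pos s_gt unfolding \<omega>_def
        by (intro mult_nonneg_nonneg) auto
      have "\<gamma> / s * step_size k \<le> 1 * step_size k"
        using step_size_bounds(1)[of k] \<gamma>_le s_gt by (intro mult_right_mono) auto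
      then show "\<omega> \<le> \<eta>" using step_size_bounds(2)[of k] by (simp add: \<omega>_def)
    qed
    have two: "a * b \<le> t' * a\<^sup>2 + b\<^sup>2 / t'" if "0 < t'" for a b t' :: real
    proof -
      have "0 \<le> ((t' * a - b)\<^sup>2 + (t' * a)\<^sup>2 + b\<^sup>2) / (2 * t')" using that by simp
      also have "\<dots> = t' * a\<^sup>2 + b\<^sup>2 / t' - a * b"
        using that by (simp add: power2_eq_square field_simps)
      finally show ?thesis by simp
    qed
    have gw: "- inner (g k) w \<le> t k * (norm (g k))\<^sup>2 + (norm (v k))\<^sup>2 / t k"
    proof -
      have "0 \<le> s * (\<beta> * (norm (g k))\<^sup>2)" using s_gt \<beta>_pos by simp
      then have "- (s * inner (g k) w) \<le> - inner (g k) (v k)"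
        using mono_at_zero[OF assms, of k] by (simp add: w_def)
      also have "\<dots> \<le> norm (g k) * norm (v k)"
        using Cauchy_Schwarz_ineq2[of "g k" "v k"] by linarith
      also have "\<dots> \<le> t k * (norm (g k))\<^sup>2 + (norm (v k))\<^sup>2 / t k" using two tk by simp
      finally have *: "- (s * inner (g k) w) \<le> t k * (norm (g k))\<^sup>2 + (norm (v k))\<^sup>2 / t k" .
      have pos: "0 \<le> t k * (norm (g k))\<^sup>2 + (norm (v k))\<^sup>2 / t k" using tk by simp
      show ?thesis
      proof (cases "0 \<le> - inner (g k) w")
        case True
        then have "1 * (- inner (g k) w) \<le> s * (- inner (g k) w)"
          using s_gt by (intro mult_right_mono) auto
        with * show ?thesis by simp
      qed (use pos in linarith)
    qed
    have ew: "inner (e k) w \<le> (t k)\<^sup>2 * (norm (e k))\<^sup>2 + B\<^sup>2 * (1 / (t k)\<^sup>2)"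
    proof -
      have "inner (e k) w \<le> norm (e k) * norm w" by (rule norm_cauchy_schwarz)
      also have "\<dots> \<le> norm (e k) * B" using B by (intro mult_left_mono) (auto simp: w_def)
      also have "\<dots> \<le> (t k)\<^sup>2 * (norm (e k))\<^sup>2 + B\<^sup>2 / (t k)\<^sup>2" using two[of "(t k)\<^sup>2"] tk by simp
      finally show ?thesis by simp
    qed
    have scale: "2 * \<omega> * a \<le> 2 * \<eta> * b" if "a \<le> b" "0 \<le> b" for a b
    proof -
      have "2 * \<omega> * a \<le> 2 * \<omega> * b" using that \<omega> by (intro mult_left_mono) auto
      also have "\<dots> \<le> 2 * \<eta> * b" using that \<omega> by (intro mult_right_mono) auto
      finally show ?thesis .
    qed
    have "(norm (z (Suc k) - xs))\<^sup>2 = (norm (w - \<omega> *\<^sub>R q k))\<^sup>2"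
      by (simp add: z_Suc w_def \<omega>_def algebra_simps)
    also have "\<dots> = (norm w)\<^sup>2 + 2 * \<omega> * (- inner (g k) w) + 2 * \<omega> * inner (e k) w + \<omega>\<^sup>2 * (norm (q k))\<^sup>2"
      unfolding power2_norm_eq_inner
      by (simp add: e_def inner_diff_left inner_diff_right inner_commute algebra_simps power2_eq_square)
    also have "\<dots> \<le> (norm w)\<^sup>2 + 2 * \<eta> * (t k * (norm (g k))\<^sup>2 + (norm (v k))\<^sup>2 / t k)
       + 2 * \<eta> * ((t k)\<^sup>2 * (norm (e k))\<^sup>2 + B\<^sup>2 * (1 / (t k)\<^sup>2)) + \<eta>\<^sup>2 * (t k * (norm (q k))\<^sup>2)"
    proof (intro add_mono order_refl)
      show "2 * \<omega> * (- inner (g k) w) \<le> 2 * \<eta> * (t k * (norm (g k))\<^sup>2 + (norm (v k))\<^sup>2 / t k)"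
        using scale[OF gw] tk by simp
      show "2 * \<omega> * inner (e k) w \<le> 2 * \<eta> * ((t k)\<^sup>2 * (norm (e k))\<^sup>2 + B\<^sup>2 * (1 / (t k)\<^sup>2))"
        using scale[OF ew] by simp
      have "1 * (norm (q k))\<^sup>2 \<le> t k * (norm (q k))\<^sup>2" using tk by (intro mult_right_mono) auto
      then show "\<omega>\<^sup>2 * (norm (q k))\<^sup>2 \<le> \<eta>\<^sup>2 * (t k * (norm (q k))\<^sup>2)"
        using \<omega> by (intro mult_mono power_mono) auto
    qed
    finally show "(norm (z (Suc k) - xs))\<^sup>2 \<le> (norm (z k - xs))\<^sup>2 + \<epsilon> k"
      by (simp add: w_def \<epsilon>_def)
  qed
qed

text \<open>The delay charge may raise \<open>E\<close> in a step, but its sum is finite by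
  \<open>summable_window_energy\<close>.\<close>

lemma E_convergent:
  assumes "xs \<in> zer G" shows "convergent (E xs)"
proof (rule quasi_decreasing_convergent[OF _ _ E_nonneg[OF assms]])
  define C where "C = \<mu> (t 0) * (\<eta> / 4 * (31 / 8 + 4 * (s - \<gamma>)))"
  show "summable (\<lambda>k. C * ((t k)\<^sup>2 * S k))"
    using summable_window_energy[OF assms] by (rule summable_mult)
  fix k
  have "\<mu> (t k) \<le> \<mu> (t 0)" by (intro \<mu>_antimono[OF t_ge]) (simp add: t_par_def)
  then have "\<mu> (t k) * ((t k)\<^sup>2 * (\<eta> / 4 * (31 / 8 + 4 * (s - \<gamma>)))) * S k
      \<le> \<mu> (t 0) * ((t k)\<^sup>2 * (\<eta> / 4 * (31 / 8 + 4 * (s - \<gamma>)))) * S k"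
    using \<eta>_pos s_gt \<gamma>_le S_nonneg by (intro mult_right_mono) auto
  then have "delay_weight (t k) * S k \<le> C * ((t k)\<^sup>2 * S k)"
    by (simp add: delay_weight_def C_def mult_ac)
  moreover have "0 \<le> \<eta> / 2 * (s - \<gamma> - 1) * t k * (norm (g k))\<^sup>2"
    using slack_pos \<eta>_pos t_gt[of k] by simp
  moreover have "0 \<le> \<mu> (t k) * t k * (t k - s) * (\<beta>' * U k)"
    using \<mu>_ge[OF t_ge, of k] t_gt[of k] \<beta>'_pos U_nonneg[of k] by simp
  ultimately show "E xs (Suc k) \<le> E xs k + C * ((t k)\<^sup>2 * S k)"
    using E_step[OF assms, of k] by linarith
qed

lemma c_convergent: "convergent (\<lambda>k. c (t k))"
proof -
  have inv: "(\<lambda>k. a / t k) \<longlonglongrightarrow> 0" for a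
    by (rule real_tendsto_divide_at_top[OF tendsto_const t_at_top])
  have "(\<lambda>k. c (t k)) \<longlonglongrightarrow> s\<^sup>2 * ((s - 1 + 0) * (1 - 0)) / (\<gamma> * \<eta>)"
    unfolding c_def \<kappa>_def \<delta>_def
    using \<gamma>_pos \<eta>_pos by (intro tendsto_intros inv) auto
  then show ?thesis by (rule convergentI)
qed

text \<open>Every other term of \<open>E\<close> converges, so the leading one does too. Summability
  of the residual weighted by \<open>t k\<close> then forces its limit to be 0.\<close>

lemma residual_limit:
  assumes "xs \<in> zer G" shows "(\<lambda>k. (t k)\<^sup>2 * (norm (g k))\<^sup>2) \<longlonglongrightarrow> 0"
proof -
  define b where "b k = t k - 1 + h" for k
  define A where "A k = (t k - 1) * b k * (norm (g k))\<^sup>2" for k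
  obtain K where K: "0 \<le> K" "\<And>k. b k * norm (g k) \<le> K"
    using residual_bounded[OF assms] unfolding b_def by blast
  have b0: "0 \<le> b k" "t k - 1 \<le> b k" "b k \<le> 2 * t k" for k
    using t_gt[of k] h_nonneg h_less[OF t_ge, of k] by (auto simp: b_def)
  have gv: "(\<lambda>k. b k * inner (g k) (v k)) \<longlonglongrightarrow> 0"
  proof (rule Lim_null_comparison)
    show "\<forall>\<^sub>F k in sequentially. norm (b k * inner (g k) (v k)) \<le> K * norm (v k)"
    proof (intro always_eventually allI)
      fix k
      have "norm (b k * inner (g k) (v k)) \<le> b k * (norm (g k) * norm (v k))"
        using b0[of k] Cauchy_Schwarz_ineq2[of "g k" "v k"] by (simp add: abs_mult mult_left_mono)
      also have "\<dots> = (b k * norm (g k)) * norm (v k)" by simp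
      also have "\<dots> \<le> K * norm (v k)" using K(2)[of k] by (intro mult_right_mono) auto
      finally show "norm (b k * inner (g k) (v k)) \<le> K * norm (v k)" .
    qed
    show "(\<lambda>k. K * norm (v k)) \<longlonglongrightarrow> 0"
      using tendsto_mult_left[OF tendsto_norm[OF v_tendsto_0[OF assms]], of K] by simp
  qed
  have "convergent (\<lambda>k. 4 / \<eta> * (E xs k + b k * inner (g k) (v k) - c (t k) * (norm (z k - xs))\<^sup>2))"
    by (rule convergent_mult[OF convergent_const convergent_diff[OF
          convergent_add[OF E_convergent[OF assms] convergentI[OF gv]]
          convergent_mult[OF c_convergent distance_convergent[OF assms]]]])
  also have "(\<lambda>k. 4 / \<eta> * (E xs k + b k * inner (g k) (v k) - c (t k) * (norm (z k - xs))\<^sup>2)) = A"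
    using \<eta>_pos by (auto simp: E_def lyap_def A_def b_def fun_eq_iff)
  finally obtain L where L: "A \<longlonglongrightarrow> L" by (auto simp: convergent_def)
  have A0: "0 \<le> A k" for k using b0[of k] t_gt[of k] by (simp add: A_def)
  have "L = 0"
  proof (rule zero_limit_if_harmonically_summable[OF L A0])
    show "summable (\<lambda>k. A k / (real k + (3 * s + \<tau>)))"
    proof (rule summable_comparison_test'[where N = 0])
      show "summable (\<lambda>k. 2 * (t k * (norm (g k))\<^sup>2))"
        using summable_residual[OF assms] by (rule summable_mult)
      fix k
      have "A k \<le> (t k * (2 * t k)) * (norm (g k))\<^sup>2"
        unfolding A_def using b0[of k] t_gt[of k] by (intro mult_right_mono mult_mono) auto
      then have "A k / t k \<le> (t k * (2 * t k)) * (norm (g k))\<^sup>2 / t k"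
        using t_gt[of k] by (intro divide_right_mono) auto
      then have "A k / t k \<le> 2 * (t k * (norm (g k))\<^sup>2)"
        using t_gt[of k] by simp
      moreover have "0 \<le> A k / t k" using A0[of k] t_gt[of k] by simp
      ultimately show "norm (A k / (real k + (3 * s + \<tau>))) \<le> 2 * (t k * (norm (g k))\<^sup>2)"
        by (simp flip: t_as_shift)
    qed
  qed (use s_gt \<tau>_ge in auto)
  with L have A_lim: "A \<longlonglongrightarrow> 0" by simp
  show ?thesis
  proof (rule Lim_null_comparison)
    show "\<forall>\<^sub>F k in sequentially. norm ((t k)\<^sup>2 * (norm (g k))\<^sup>2) \<le> 4 * A k"
    proof (intro always_eventually allI)
      fix k
      \<comment> \<open>Each factor uses \<open>t k \<le> 2 * (t k - 1)\<close>, valid as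
        \<open>4 \<le> t k\<close>.\<close>
      have "t k * t k \<le> (2 * (t k - 1)) * (2 * b k)"
        using t_gt[of k] b0[of k] by (intro mult_mono) auto
      then have "t k * t k * (norm (g k))\<^sup>2 \<le> (2 * (t k - 1)) * (2 * b k) * (norm (g k))\<^sup>2"
        by (intro mult_right_mono) auto
      also have "\<dots> = 4 * A k" by (simp add: A_def)
      finally show "norm ((t k)\<^sup>2 * (norm (g k))\<^sup>2) \<le> 4 * A k"
        by (simp add: power2_eq_square)
    qed
    show "(\<lambda>k. 4 * A k) \<longlonglongrightarrow> 0" using tendsto_mult_left[OF A_lim, of 4] by simp
  qed
qed

lemma g_tendsto_0:
  assumes "xs \<in> zer G" shows "g \<longlonglongrightarrow> 0"
proof (rule norm_tendsto_0_of_square[OF residual_limit[OF assms]])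
  show "(norm (g k))\<^sup>2 \<le> (t k)\<^sup>2 * (norm (g k))\<^sup>2" for k
    using mult_right_mono[of 1 "(t k)\<^sup>2" "(norm (g k))\<^sup>2"] t_gt[of k] by simp
qed

lemma q_tendsto_0:
  assumes "xs \<in> zer G" shows "q \<longlonglongrightarrow> 0"
proof (rule norm_tendsto_0_of_square[OF summable_LIMSEQ_zero[OF summable_estimator[OF assms]]])
  show "(norm (q k))\<^sup>2 \<le> t k * (norm (q k))\<^sup>2" for k
    using mult_right_mono[of 1 "t k" "(norm (q k))\<^sup>2"] t_gt[of k] by simp
qed

text \<open>A cluster point of \<open>z\<close> is a zero by continuity of \<open>G\<close>. The
  distance to this zero converges and vanishes along the subsequence, hence vanishes in the
  limit.\<close>

lemma iterates_converge:
  assumes "xs \<in> zer G"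
  obtains l where "l \<in> zer G" "x \<longlonglongrightarrow> l" "y \<longlonglongrightarrow> l" "z \<longlonglongrightarrow> l"
proof -
  have zy: "(\<lambda>k. z k - y k) \<longlonglongrightarrow> 0"
  proof -
    have "(\<lambda>k. (1 / s) *\<^sub>R v k) \<longlonglongrightarrow> (1 / s) *\<^sub>R 0"
      using v_tendsto_0[OF assms] by (intro tendsto_intros)
    then show ?thesis using s_gt by (simp add: v_def)
  qed
  obtain B where "\<And>k. norm (z k - xs) \<le> B" using z_bounded[OF assms] by blast
  then have "bounded (range z)"
    unfolding bounded_def by (auto simp: dist_norm norm_minus_commute intro!: exI[of _ xs])
  then obtain l r where r: "strict_mono r" and zl: "(z \<circ> r) \<longlonglongrightarrow> l"
    using bounded_imp_convergent_subsequence by blast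
  have "(\<lambda>k. z (r k) - (z (r k) - y (r k))) \<longlonglongrightarrow> l - 0"
    using zl LIMSEQ_subseq_LIMSEQ[OF zy r] by (intro tendsto_diff) (auto simp: o_def)
  then have "(\<lambda>k. y (r k)) \<longlonglongrightarrow> l" by simp
  then have "(\<lambda>k. G (y (r k))) \<longlonglongrightarrow> G l"
    using continuous_G by (intro continuous_on_tendsto_compose[where f = G]) auto
  moreover have "(\<lambda>k. G (y (r k))) \<longlonglongrightarrow> 0"
    using LIMSEQ_subseq_LIMSEQ[OF g_tendsto_0[OF assms] r] by (simp add: o_def)
  ultimately have "G l = 0" by (rule LIMSEQ_unique)
  then have l: "l \<in> zer G" by (simp add: zer_def)
  obtain m where m: "(\<lambda>k. (norm (z k - l))\<^sup>2) \<longlonglongrightarrow> m"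
    using distance_convergent[OF l] by (auto simp: convergent_def)
  have "(\<lambda>k. (norm ((z \<circ> r) k - l))\<^sup>2) \<longlonglongrightarrow> (norm (l - l))\<^sup>2"
    using zl by (intro tendsto_intros)
  moreover have "(\<lambda>k. (norm ((z \<circ> r) k - l))\<^sup>2) \<longlonglongrightarrow> m"
    using LIMSEQ_subseq_LIMSEQ[OF m r] by (simp add: o_def)
  ultimately have "(norm (l - l))\<^sup>2 = m" by (rule LIMSEQ_unique)
  then have "m = 0" by simp
  with m have "(\<lambda>k. (norm (z k - l))\<^sup>2) \<longlonglongrightarrow> 0" by simp
  then have "(\<lambda>k. z k - l) \<longlonglongrightarrow> 0" by (rule norm_tendsto_0_of_square) simp
  then have z: "z \<longlonglongrightarrow> l" by (simp add: LIM_zero_iff)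
  have "(\<lambda>k. z k - (z k - y k)) \<longlonglongrightarrow> l - 0" using z zy by (rule tendsto_diff)
  then have y: "y \<longlonglongrightarrow> l" by simp
  have "(\<lambda>k. step_size k *\<^sub>R q k) \<longlonglongrightarrow> 0"
  proof (rule Lim_null_comparison)
    show "\<forall>\<^sub>F k in sequentially. norm (step_size k *\<^sub>R q k) \<le> \<eta> * norm (q k)"
    proof (intro always_eventually allI)
      fix k
      have "norm (step_size k *\<^sub>R q k) = step_size k * norm (q k)"
        using step_size_bounds(1)[of k] by (simp only: norm_scaleR abs_of_pos)
      also have "\<dots> \<le> \<eta> * norm (q k)" using step_size_bounds(2)[of k] by (intro mult_right_mono) auto
      finally show "norm (step_size k *\<^sub>R q k) \<le> \<eta> * norm (q k)" .
    qed
    show "(\<lambda>k. \<eta> * norm (q k)) \<longlonglongrightarrow> 0"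
      using tendsto_mult_left[OF tendsto_norm[OF q_tendsto_0[OF assms]], of \<eta>] by simp
  qed
  \<comment> \<open>The scheme determines \<open>x\<close> only from index 1 on; the arbitrary
    \<open>x 0\<close> does not affect the limit.\<close>
  from tendsto_diff[OF y this] have "(\<lambda>k. x (Suc k)) \<longlonglongrightarrow> l" by (simp add: x_Suc)
  then have "x \<longlonglongrightarrow> l" by (rule LIMSEQ_imp_Suc)
  with l y z show ?thesis by (intro that)
qed

end

section \<open>The two step-size regimes and the iteration count\<close>

lemma step_size_conditions:
  assumes "0 < \<gamma>" "\<gamma> \<le> 1" "1 + 3 * \<gamma> \<le> s" "1 \<le> \<tau>" "0 \<le> \<beta>"
    and "0 < \<eta>" and le: "\<eta> \<le> eta_bar \<gamma> s \<tau> \<beta> \<beta>'"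
  shows "\<eta> * (1 + \<tau>) \<le> \<beta>" "7 * (1 + s - \<gamma>) * \<tau> * \<eta> \<le> 3 * \<beta>'"
proof -
  define L where "L = 7 * (1 + s - \<gamma>) * \<tau>"
  have L: "0 < L" using assms by (simp add: L_def)
  have T: "0 < 1 + \<tau>" using assms by simp
  define Y where "Y = \<beta> / (1 + \<tau>)"
  \<comment> \<open>In this form the threshold is visibly the value of \<beta>' at which
    \<open>3 * \<beta>' / L\<close> and \<open>Y\<close> agree; on either side
    \<open>eta_bar\<close> is the smaller of the two.\<close>
  have thr: "threshold \<gamma> s \<tau> \<beta> = L * Y / 3"
    by (simp add: threshold_def L_def Y_def)
  have eb: "eta_bar \<gamma> s \<tau> \<beta> \<beta>' = (if 0 < \<beta>' \<and> \<beta>' \<le> threshold \<gamma> s \<tau> \<beta> then 3 * \<beta>' / L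
      else if \<beta>' \<ge> threshold \<gamma> s \<tau> \<beta> then Y else 0)"
    by (simp add: eta_bar_def L_def Y_def)
  have "\<eta> \<le> Y \<and> L * \<eta> \<le> 3 * \<beta>'"
  proof (cases "0 < \<beta>' \<and> \<beta>' \<le> threshold \<gamma> s \<tau> \<beta>")
    case True
    then have 1: "L * \<eta> \<le> 3 * \<beta>'" using le L by (simp add: eb pos_le_divide_eq mult.commute)
    also have "\<dots> \<le> L * Y" using True unfolding thr by linarith
    finally show ?thesis using L 1 by (simp only: mult_le_cancel_left_pos)
  next
    case False
    then have "\<eta> \<le> (if \<beta>' \<ge> threshold \<gamma> s \<tau> \<beta> then Y else 0)"
      using le unfolding eb by (simp only: if_False)
    \<comment> \<open>The default value 0 of \<open>eta_bar\<close> contradicts the positive step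
      size, so the second regime must hold.\<close>
    then have ge: "threshold \<gamma> s \<tau> \<beta> \<le> \<beta>'" and 1: "\<eta> \<le> Y"
      using assms(6) by (auto split: if_splits)
    then have "L * \<eta> \<le> L * Y" using L by (intro mult_left_mono) auto
    then show ?thesis using ge 1 unfolding thr by linarith
  qed
  then show "\<eta> * (1 + \<tau>) \<le> \<beta>" "7 * (1 + s - \<gamma>) * \<tau> * \<eta> \<le> 3 * \<beta>'"
    using T by (auto simp: pos_le_divide_eq L_def Y_def)
qed

text \<open>The regimes overlap at the threshold, where the definition picks the first formula for
  positive \<beta>'. The agreement of both formulas closes this case.\<close>

lemma eta_bar_above_threshold:
  assumes "0 < s" "\<gamma> \<le> 1" "1 \<le> \<tau>" "threshold \<gamma> s \<tau> \<beta> \<le> \<beta>'"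
  shows "eta_bar \<gamma> s \<tau> \<beta> \<beta>' = \<beta> / (1 + \<tau>)"
proof (cases "\<beta>' = threshold \<gamma> s \<tau> \<beta>")
  case True
  have "3 * threshold \<gamma> s \<tau> \<beta> / (7 * (1 + s - \<gamma>) * \<tau>) = \<beta> / (1 + \<tau>)"
    using assms by (simp add: threshold_def divide_simps)
  with True show ?thesis by (simp add: eta_bar_def)
next
  case False
  with assms(4) show ?thesis by (simp add: eta_bar_def)
qed

context afp_params
begin

text \<open>The iteration count needs the square root of the rate constant. A sum of squares is
  bounded by the square of the sum, which is linear in \<open>a\<close>, \<open>D\<close> and
  \<open>1 / \<eta>\<close>.\<close>

lemma initial_rate:
  assumes "0 \<le> a" "0 \<le> D"
  shows "4 * (\<eta> * (3 * s + \<tau> - 1)\<^sup>2 / 2 * a\<^sup>2 + 2 * s ^ 3 / (\<eta> * \<gamma>) * D\<^sup>2) / \<eta>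
     \<le> (6 * s * \<tau> * a + 8 * s\<^sup>2 * D / (\<gamma> * \<eta>))\<^sup>2"
proof -
  have "0 \<le> (3 * s - 1) * (\<tau> - 1)" using s_gt \<tau>_ge by simp
  then have "3 * s + \<tau> - 1 \<le> 3 * s * \<tau>" by (simp add: algebra_simps)
  then have "2 * (3 * s + \<tau> - 1)\<^sup>2 * a\<^sup>2 \<le> 4 * (3 * s * \<tau>)\<^sup>2 * a\<^sup>2"
    using s_gt \<tau>_ge by (intro mult_right_mono mult_mono power_mono) auto
  also have "\<dots> = (6 * s * \<tau> * a)\<^sup>2" by (simp add: power_mult_distrib)
  finally have 1: "2 * (3 * s + \<tau> - 1)\<^sup>2 * a\<^sup>2 \<le> (6 * s * \<tau> * a)\<^sup>2" .
  have "\<gamma> * 1 \<le> 1 * (8 * s)" using \<gamma>_pos \<gamma>_le s_gt by (intro mult_mono) auto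
  then have "8 * s ^ 3 * \<gamma> * (D\<^sup>2 / (\<gamma> * \<eta>)\<^sup>2) \<le> 8 * s ^ 3 * (8 * s) * (D\<^sup>2 / (\<gamma> * \<eta>)\<^sup>2)"
    using s_gt by (intro mult_right_mono mult_left_mono) auto
  also have "\<dots> = (8 * s\<^sup>2 * D / (\<gamma> * \<eta>))\<^sup>2"
    by (simp add: power_mult_distrib power_divide power2_eq_square power3_eq_cube)
  finally have 2: "8 * s ^ 3 / (\<eta>\<^sup>2 * \<gamma>) * D\<^sup>2 \<le> (8 * s\<^sup>2 * D / (\<gamma> * \<eta>))\<^sup>2"
    using \<gamma>_pos by (simp add: power2_eq_square mult_ac)
  have "0 \<le> 2 * (6 * s * \<tau> * a) * (8 * s\<^sup>2 * D / (\<gamma> * \<eta>))"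
    using assms s_gt \<tau>_ge \<gamma>_pos \<eta>_pos by simp
  then have "(6 * s * \<tau> * a)\<^sup>2 + (8 * s\<^sup>2 * D / (\<gamma> * \<eta>))\<^sup>2 \<le> (6 * s * \<tau> * a + 8 * s\<^sup>2 * D / (\<gamma> * \<eta>))\<^sup>2"
    by (simp add: power2_sum)
  moreover have "4 * (\<eta> * (3 * s + \<tau> - 1)\<^sup>2 / 2 * a\<^sup>2 + 2 * s ^ 3 / (\<eta> * \<gamma>) * D\<^sup>2) / \<eta>
      = 2 * (3 * s + \<tau> - 1)\<^sup>2 * a\<^sup>2 + 8 * s ^ 3 / (\<eta>\<^sup>2 * \<gamma>) * D\<^sup>2"
    using \<eta>_pos \<gamma>_pos by (simp add: field_simps power2_eq_square)
  ultimately show ?thesis using 1 2 by linarith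
qed

text \<open>Here \<open>\<eta>0\<close> stands for the maximal step size and \<open>b\<close> for
  the constant of the current regime. Writing \<eta> as \<open>\<eta> / \<eta>0\<close> times
  \<open>\<eta>0\<close> and using \<open>b \<le> 5 * s * \<tau> * \<eta>0\<close> moves \<tau> and
  \<open>b\<close> out of \<open>K\<close>.\<close>

lemma iteration_count:
  fixes m :: "nat \<Rightarrow> real"
  assumes "0 \<le> a" "0 \<le> D" "0 < \<epsilon>" "0 < b" and b: "b \<le> 5 * s * \<tau> * \<eta>0" and "0 < \<eta>0"
    and m: "\<And>j. m j \<le> 4 * (\<eta> * (3 * s + \<tau> - 1)\<^sup>2 / 2 * a\<^sup>2 + 2 * s ^ 3 / (\<eta> * \<gamma>) * D\<^sup>2) / (\<eta> * (real j + 3 * s + \<tau> - 1)\<^sup>2)"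
  defines "K \<equiv> 6 * s * a + 40 * s ^ 3 * D / (\<gamma> * (\<eta> / \<eta>0))"
  shows "\<exists>k. real k \<le> K * (\<tau> / \<epsilon> + \<tau> / (b * \<epsilon>)) \<and> (\<forall>j\<ge>k. m j \<le> \<epsilon>\<^sup>2)"
proof -
  define X where "X = K * (\<tau> / \<epsilon> + \<tau> / (b * \<epsilon>))"
  define W where "W = 6 * s * \<tau> * a + 8 * s\<^sup>2 * D / (\<gamma> * \<eta>)"
  have p1: "0 \<le> 6 * s * a" and p2: "0 \<le> 40 * s ^ 3 * D / (\<gamma> * (\<eta> / \<eta>0))"
    using assms s_gt \<gamma>_pos \<eta>_pos by auto
  then have K0: "0 \<le> K" by (simp add: K_def)
  have X0: "0 \<le> X" using K0 assms \<tau>_ge by (simp add: X_def)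
  have W0: "0 \<le> W" using assms s_gt \<tau>_ge \<gamma>_pos \<eta>_pos by (simp add: W_def)
  have "8 * s\<^sup>2 * D / (\<gamma> * \<eta>) * b \<le> 8 * s\<^sup>2 * D / (\<gamma> * \<eta>) * (5 * s * \<tau> * \<eta>0)"
    using b assms s_gt \<gamma>_pos \<eta>_pos by (intro mult_left_mono) auto
  also have "\<dots> = 40 * s ^ 3 * D / (\<gamma> * (\<eta> / \<eta>0)) * \<tau>"
    using assms(6) by (simp add: power2_eq_square power3_eq_cube)
  also have "\<dots> \<le> K * \<tau>" using p1 \<tau>_ge unfolding K_def by (intro mult_right_mono) auto
  finally have "8 * s\<^sup>2 * D / (\<gamma> * \<eta>) \<le> K * \<tau> / b" using assms(4) by (simp only: pos_le_divide_eq)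
  moreover have "6 * s * a * \<tau> \<le> K * \<tau>" using p2 \<tau>_ge unfolding K_def by (intro mult_right_mono) auto
  ultimately have "W \<le> K * \<tau> + K * \<tau> / b" by (simp add: W_def mult_ac)
  also have "\<dots> = \<epsilon> * X" using assms(3,4) by (simp add: X_def field_simps)
  finally have WX: "W \<le> \<epsilon> * X" .
  \<comment> \<open>Rounding down keeps the count below \<open>X\<close>; the lost fraction is
    recovered from \<open>3 * s + \<tau> - 1\<close>, which exceeds 1.\<close>
  have "m j \<le> \<epsilon>\<^sup>2" if "nat \<lfloor>X\<rfloor> \<le> j" for j
  proof -
    define u where "u = real j + 3 * s + \<tau> - 1"
    have u: "X \<le> u" "0 < u" using that X0 s_gt \<tau>_ge unfolding u_def by linarith+
    have "W \<le> \<epsilon> * u" using WX u(1) assms(3) by (meson mult_left_mono less_imp_le order_trans)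
    then have "W\<^sup>2 \<le> (\<epsilon> * u)\<^sup>2" using W0 by (rule power_mono)
    have "m j \<le> 4 * (\<eta> * (3 * s + \<tau> - 1)\<^sup>2 / 2 * a\<^sup>2 + 2 * s ^ 3 / (\<eta> * \<gamma>) * D\<^sup>2) / \<eta> / u\<^sup>2"
      using m[of j] by (simp add: u_def)
    also have "\<dots> \<le> W\<^sup>2 / u\<^sup>2"
      using initial_rate[OF assms(1,2)] by (intro divide_right_mono) (auto simp: W_def)
    also have "\<dots> \<le> (\<epsilon> * u)\<^sup>2 / u\<^sup>2" using \<open>W\<^sup>2 \<le> (\<epsilon> * u)\<^sup>2\<close> by (intro divide_right_mono) auto
    also have "\<dots> = \<epsilon>\<^sup>2" using u by (simp add: power_mult_distrib)
    finally show ?thesis .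
  qed
  moreover have "real (nat \<lfloor>X\<rfloor>) \<le> X" using X0 by linarith
  ultimately show ?thesis unfolding X_def by blast
qed

end

text \<open>The component part of the cocoercivity bound is at most the product of the norms of
  \<open>G a - G b\<close> and \<open>a - b\<close>, and \<open>G\<close> is Lipschitz. Continuity
  makes the random estimator measurable.\<close>

lemma (in afp_path) continuous_Gs:
  assumes "i \<in> {1..n}" shows "continuous_on UNIV (Gs i)"
proof -
  define C where "C = real n / (\<beta> * \<beta>')"
  have n0: "0 < real n" using n_ge by simp
  have "norm (Gs i a - Gs i b) \<le> sqrt C * norm (a - b)" for a b
  proof -
    have "(norm (Gs i a - Gs i b))\<^sup>2 \<le> (\<Sum>i=1..n. (norm (Gs i a - Gs i b))\<^sup>2)"
      using assms by (intro member_le_sum) auto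
    then have "\<beta> * (\<beta>' / real n * (norm (Gs i a - Gs i b))\<^sup>2)
        \<le> \<beta> * (\<beta>' / real n * (\<Sum>i=1..n. (norm (Gs i a - Gs i b))\<^sup>2))"
      using \<beta>_pos \<beta>'_pos by (intro mult_left_mono) auto
    also have "\<dots> \<le> \<beta> * inner (G a - G b) (a - b)"
    proof -
      have "0 \<le> \<beta> * (norm (G a - G b))\<^sup>2" using \<beta>_pos by simp
      then have "\<beta>' / real n * (\<Sum>i=1..n. (norm (Gs i a - Gs i b))\<^sup>2) \<le> inner (G a - G b) (a - b)"
        using coco_dest[of a b] by linarith
      then show ?thesis using \<beta>_pos by (intro mult_left_mono) auto
    qed
    also have "\<dots> \<le> \<beta> * (norm (G a - G b) * norm (a - b))"
      using \<beta>_pos norm_cauchy_schwarz by (intro mult_left_mono) auto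
    also have "\<dots> = (\<beta> * norm (G a - G b)) * norm (a - b)" by simp
    also have "\<dots> \<le> norm (a - b) * norm (a - b)"
      using lipschitz_G by (intro mult_right_mono) auto
    finally have "(norm (Gs i a - Gs i b))\<^sup>2 \<le> C * (norm (a - b))\<^sup>2"
      using \<beta>_pos \<beta>'_pos n0 by (simp add: C_def field_simps power2_eq_square)
    then have "norm (Gs i a - Gs i b) \<le> sqrt (C * (norm (a - b))\<^sup>2)" by (rule real_le_rsqrt)
    then show ?thesis by (simp add: real_sqrt_mult)
  qed
  then have "(sqrt C)-lipschitz_on UNIV (Gs i)"
    using \<beta>_pos \<beta>'_pos by (intro lipschitz_onI) (auto simp: dist_norm C_def)
  then show ?thesis by (rule lipschitz_on_continuous_on)
qed

section \<open>Random delays\<close>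

locale afp_random = afp_params \<gamma> s \<tau> \<eta> \<beta> \<beta>' + prob_space M
  for \<gamma> s \<tau> \<eta> \<beta> \<beta>' and M :: "'w measure" +
  fixes n :: nat and Gs :: "nat \<Rightarrow> 'v \<Rightarrow> 'v::euclidean_space" and G :: "'v \<Rightarrow> 'v"
    and d :: "nat \<Rightarrow> nat \<Rightarrow> 'w \<Rightarrow> nat" and y0 xs :: 'v and x y z :: "nat \<Rightarrow> 'w \<Rightarrow> 'v"
  assumes path: "\<And>\<omega>. \<omega> \<in> space M \<Longrightarrow> afp_path \<gamma> s \<tau> \<eta> \<beta> \<beta>' n Gs G (\<lambda>i k. d i k \<omega>) y0
      (\<lambda>k. x k \<omega>) (\<lambda>k. y k \<omega>) (\<lambda>k. z k \<omega>)"
    and d_measurable: "\<And>i k. i \<in> {1..n} \<Longrightarrow> d i k \<in> measurable M (count_space UNIV)"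
    and xs: "xs \<in> zer G"
begin

lemma G_measurable: "G \<in> borel_measurable borel"
  and Gs_measurable: "i \<in> {1..n} \<Longrightarrow> Gs i \<in> borel_measurable borel"
proof -
  obtain \<omega> where "\<omega> \<in> space M" using not_empty by blast
  then interpret afp_path \<gamma> s \<tau> \<eta> \<beta> \<beta>' n Gs G "\<lambda>i k. d i k \<omega>" y0 "\<lambda>k. x k \<omega>" "\<lambda>k. y k \<omega>" "\<lambda>k. z k \<omega>"
    by (rule path)
  show "G \<in> borel_measurable borel" using continuous_G by (rule borel_measurable_continuous_onI)
  show "i \<in> {1..n} \<Longrightarrow> Gs i \<in> borel_measurable borel"
    using continuous_Gs by (rule borel_measurable_continuous_onI)
qed

text \<open>Measurability is derived from that of the delays. The induction carries all earlier
  \<open>y j\<close>, because the estimator reads \<open>y\<close> at random earlier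
  indices.\<close>

lemma iterates_measurable_upto:
  "(\<forall>j\<le>k. y j \<in> borel_measurable M) \<and> z k \<in> borel_measurable M"
proof (induction k)
  case 0
  have init: "y 0 \<omega> = y0" "z 0 \<omega> = y0" if "\<omega> \<in> space M" for \<omega>
    using afp_path.init[OF path[OF that]] by auto
  have "y 0 \<in> borel_measurable M \<longleftrightarrow> (\<lambda>_. y0) \<in> borel_measurable M"
    and "z 0 \<in> borel_measurable M \<longleftrightarrow> (\<lambda>_. y0) \<in> borel_measurable M"
    using init by (intro measurable_cong; blast)+
  then show ?case by simp
next
  case (Suc k)
  let ?t = "t_par s \<tau> k"
  define Q where "Q \<omega> = delayed_estimator n Gs (\<lambda>i k. d i k \<omega>) (\<lambda>k. y k \<omega>) k" for \<omega>
  define Z where "Z \<omega> = z k \<omega> - (\<gamma> / s * (\<eta> * ?t / (2 * (?t - s)))) *\<^sub>R Q \<omega>" for \<omega>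
  define Y where "Y \<omega> = ((?t - s) / ?t) *\<^sub>R (y k \<omega> - (\<eta> * ?t / (2 * (?t - s))) *\<^sub>R Q \<omega>) + (s / ?t) *\<^sub>R Z \<omega>" for \<omega>
  have [measurable]: "y k \<in> borel_measurable M" "z k \<in> borel_measurable M" using Suc by auto
  have "(\<lambda>\<omega>. Gs i (y (k - d i k \<omega>) \<omega>)) \<in> borel_measurable M" if i: "i \<in> {1..n}" for i
  proof -
    have "(\<lambda>\<omega>. y (k - d i k \<omega>) \<omega>) \<in> borel_measurable M"
      \<comment> \<open>A random index with countably many values preserves measurability.\<close>
      using Suc by (intro measurable_compose_countable[OF _ d_measurable[OF i, of k], where f = "\<lambda>m \<omega>. y (k - m) \<omega>"]) auto
    then show ?thesis by (rule measurable_compose[OF _ Gs_measurable[OF i]])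
  qed
  then have [measurable]: "Q \<in> borel_measurable M"
    unfolding Q_def delayed_estimator_def by (intro borel_measurable_scaleR borel_measurable_sum borel_measurable_const) auto
  have [measurable]: "Z \<in> borel_measurable M" unfolding Z_def by measurable
  have [measurable]: "Y \<in> borel_measurable M" unfolding Y_def by measurable
  have "z (Suc k) \<omega> = Z \<omega>" "y (Suc k) \<omega> = Y \<omega>" if \<omega>: "\<omega> \<in> space M" for \<omega>
  proof -
    interpret afp_path \<gamma> s \<tau> \<eta> \<beta> \<beta>' n Gs G "\<lambda>i k. d i k \<omega>" y0 "\<lambda>k. x k \<omega>" "\<lambda>k. y k \<omega>" "\<lambda>k. z k \<omega>"
      using \<omega> by (rule path)
    have Q: "q k = Q \<omega>" by (simp add: q_def Q_def)
    show Z: "z (Suc k) \<omega> = Z \<omega>" using z_Suc[of k] by (simp add: Q Z_def)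
    show "y (Suc k) \<omega> = Y \<omega>"
      using scheme x_Suc[of k] by (simp add: afp_scheme_def Q Z[symmetric] Y_def)
  qed
  note step = this
  have "z (Suc k) \<in> borel_measurable M \<longleftrightarrow> Z \<in> borel_measurable M"
    and "y (Suc k) \<in> borel_measurable M \<longleftrightarrow> Y \<in> borel_measurable M"
    using step by (intro measurable_cong; blast)+
  then show ?case using Suc by (auto simp: le_Suc_eq)
qed

lemma y_measurable [measurable]: "y k \<in> borel_measurable M"
  and z_measurable [measurable]: "z k \<in> borel_measurable M"
  using iterates_measurable_upto by auto

abbreviation R :: real where "R \<equiv> R0_sq \<gamma> s \<tau> \<eta> G y0 xs"

lemma residual_measurable [measurable]: "(\<lambda>\<omega>. (norm (G (y k \<omega>)))\<^sup>2) \<in> borel_measurable M"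
proof -
  have [measurable]: "(\<lambda>\<omega>. G (y k \<omega>)) \<in> borel_measurable M"
    by (rule measurable_compose[OF y_measurable G_measurable])
  show ?thesis by measurable
qed

lemma shift_pos: "0 < real k + 3 * s + \<tau> - 1" using s_gt \<tau>_ge by linarith

lemma path_bound:
  assumes "\<omega> \<in> space M"
  shows "(norm (G (y k \<omega>)))\<^sup>2 \<le> 4 * R / (\<eta> * (real k + 3 * s + \<tau> - 1)\<^sup>2)"
proof -
  have "\<eta> * (real k + 3 * s + \<tau> - 1)\<^sup>2 / 4 * (norm (G (y k \<omega>)))\<^sup>2 \<le> R"
    by (rule afp_path.residual_bound[OF path[OF assms] xs])
  then show ?thesis using shift_pos[of k] \<eta>_pos by (simp add: pos_le_divide_eq mult_ac)
qed

lemma residual_integrable: "integrable M (\<lambda>\<omega>. (norm (G (y k \<omega>)))\<^sup>2)"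
  by (rule integrable_const_bound[where B = "4 * R / (\<eta> * (real k + 3 * s + \<tau> - 1)\<^sup>2)"])
    (use path_bound in auto)

lemma expectation_bound:
  "(\<integral>\<omega>. (norm (G (y k \<omega>)))\<^sup>2 \<partial>M) \<le> 4 * R / (\<eta> * (real k + 3 * s + \<tau> - 1)\<^sup>2)"
  using path_bound by (intro integral_le_const residual_integrable) auto

lemma path_limit:
  assumes "\<omega> \<in> space M"
  shows "(\<lambda>k. (real k + \<tau>)\<^sup>2 * (norm (G (y k \<omega>)))\<^sup>2) \<longlonglongrightarrow> 0"
proof (rule Lim_null_comparison[OF _ afp_path.residual_limit[OF path[OF assms] xs]])
  have "(real k + \<tau>)\<^sup>2 \<le> (t_par s \<tau> k)\<^sup>2" for k
    using s_gt \<tau>_ge by (intro power_mono) (auto simp: t_par_def)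
  then show "\<forall>\<^sub>F k in sequentially. norm ((real k + \<tau>)\<^sup>2 * (norm (G (y k \<omega>)))\<^sup>2)
      \<le> (t_par s \<tau> k)\<^sup>2 * (norm (G (y k \<omega>)))\<^sup>2"
    by (intro always_eventually allI) (simp add: mult_right_mono)
qed

lemma path_summable:
  assumes "\<omega> \<in> space M"
  shows "summable (\<lambda>k. (real k + \<tau>) * (norm (G (y k \<omega>)))\<^sup>2)"
proof (rule summable_comparison_test'[where N = 0, OF afp_path.summable_residual[OF path[OF assms] xs]])
  show "norm ((real k + \<tau>) * (norm (G (y k \<omega>)))\<^sup>2) \<le> t_par s \<tau> k * (norm (G (y k \<omega>)))\<^sup>2" for k
    using s_gt \<tau>_ge by (auto simp: t_par_def abs_mult intro!: mult_right_mono)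
qed

text \<open>Dominated convergence: the bound on each path, multiplied by the square of
  \<open>real k + \<tau>\<close>, is at most the constant \<open>4 * R / \<eta>\<close>.\<close>

lemma expectation_limit: "(\<lambda>k. (real k + \<tau>)\<^sup>2 * (\<integral>\<omega>. (norm (G (y k \<omega>)))\<^sup>2 \<partial>M)) \<longlonglongrightarrow> 0"
proof -
  have "(\<lambda>k. \<integral>\<omega>. (real k + \<tau>)\<^sup>2 * (norm (G (y k \<omega>)))\<^sup>2 \<partial>M) \<longlonglongrightarrow> (\<integral>\<omega>. 0 \<partial>M)"
  proof (rule integral_dominated_convergence[where w = "\<lambda>_. 4 * R / \<eta>"])
    show "AE \<omega> in M. (\<lambda>k. (real k + \<tau>)\<^sup>2 * (norm (G (y k \<omega>)))\<^sup>2) \<longlonglongrightarrow> 0"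
      using path_limit by auto
    fix k
    show "AE \<omega> in M. norm ((real k + \<tau>)\<^sup>2 * (norm (G (y k \<omega>)))\<^sup>2) \<le> 4 * R / \<eta>"
    proof (rule AE_I2)
      fix \<omega> assume \<omega>: "\<omega> \<in> space M"
      have "(real k + \<tau>)\<^sup>2 * (norm (G (y k \<omega>)))\<^sup>2 \<le> (real k + 3 * s + \<tau> - 1)\<^sup>2 * (norm (G (y k \<omega>)))\<^sup>2"
        using s_gt \<tau>_ge by (intro mult_right_mono power_mono) auto
      also have "\<dots> \<le> (real k + 3 * s + \<tau> - 1)\<^sup>2 * (4 * R / (\<eta> * (real k + 3 * s + \<tau> - 1)\<^sup>2))"
        using path_bound[OF \<omega>] by (intro mult_left_mono) auto
      also have "\<dots> = 4 * R / \<eta>" using shift_pos[of k] by simp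
      finally show "norm ((real k + \<tau>)\<^sup>2 * (norm (G (y k \<omega>)))\<^sup>2) \<le> 4 * R / \<eta>" by simp
    qed
  qed auto
  then show ?thesis by simp
qed

text \<open>The limit is read off from \<open>z\<close>, whose terms are all known to be
  measurable.\<close>

lemma random_limit:
  obtains xlim where "xlim \<in> borel_measurable M"
    "\<And>\<omega>. \<omega> \<in> space M \<Longrightarrow> xlim \<omega> \<in> zer G \<and> (\<lambda>k. x k \<omega>) \<longlonglongrightarrow> xlim \<omega>
       \<and> (\<lambda>k. y k \<omega>) \<longlonglongrightarrow> xlim \<omega> \<and> (\<lambda>k. z k \<omega>) \<longlonglongrightarrow> xlim \<omega>"
proof
  show "(\<lambda>\<omega>. lim (\<lambda>k. z k \<omega>)) \<in> borel_measurable M" by (rule borel_measurable_lim_metric) measurable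
  fix \<omega> assume "\<omega> \<in> space M"
  then obtain l where "l \<in> zer G" "(\<lambda>k. x k \<omega>) \<longlonglongrightarrow> l" "(\<lambda>k. y k \<omega>) \<longlonglongrightarrow> l" "(\<lambda>k. z k \<omega>) \<longlonglongrightarrow> l"
    using afp_path.iterates_converge[OF path xs] by blast
  then show "lim (\<lambda>k. z k \<omega>) \<in> zer G \<and> (\<lambda>k. x k \<omega>) \<longlonglongrightarrow> lim (\<lambda>k. z k \<omega>)
       \<and> (\<lambda>k. y k \<omega>) \<longlonglongrightarrow> lim (\<lambda>k. z k \<omega>) \<and> (\<lambda>k. z k \<omega>) \<longlonglongrightarrow> lim (\<lambda>k. z k \<omega>)"
    by (simp add: limI)
qed

end

text \<open>The constant of the complexity bounds is quantified first and hence uniform over all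
  problems. It may depend on the ratio of \<eta> to its maximum, since a smaller step size enlarges
  the distance part of the rate constant.\<close>

theorem corollary3:
  shows "\<exists>C :: real \<Rightarrow> real \<Rightarrow> real \<Rightarrow> real \<Rightarrow> real \<Rightarrow> real.
    \<forall>(M :: 'w measure) (n :: nat)
     (Gs :: nat \<Rightarrow> real ^ 'p \<Rightarrow> real ^ 'p) (G :: real ^ 'p \<Rightarrow> real ^ 'p)
     (\<beta> :: real) (\<beta>' :: real) (\<gamma> :: real) (s :: real) (\<tau> :: real) (\<eta> :: real)
     (d :: nat \<Rightarrow> nat \<Rightarrow> 'w \<Rightarrow> nat) (y0 :: real ^ 'p) (xs :: real ^ 'p)
     (x :: nat \<Rightarrow> 'w \<Rightarrow> real ^ 'p) (y :: nat \<Rightarrow> 'w \<Rightarrow> real ^ 'p) (z :: nat \<Rightarrow> 'w \<Rightarrow> real ^ 'p).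
      prob_space M \<longrightarrow>
      n \<ge> 1 \<longrightarrow>
      finite_sum_form n Gs G \<longrightarrow>
      zer G \<noteq> {} \<longrightarrow>
      \<beta> \<ge> 0 \<longrightarrow> \<beta>' \<ge> 0 \<longrightarrow>
      finite_sum_cocoercive \<beta> \<beta>' n Gs G \<longrightarrow>
      0 < \<gamma> \<longrightarrow> \<gamma> \<le> 1 \<longrightarrow> s \<ge> 1 + 3 * \<gamma> \<longrightarrow> \<tau> \<ge> 1 \<longrightarrow>
      0 < \<eta> \<longrightarrow> \<eta> \<le> eta_bar \<gamma> s \<tau> \<beta> \<beta>' \<longrightarrow>
      (\<forall>i\<in>{1..n}. \<forall>k. d i k \<in> measurable M (count_space UNIV)) \<longrightarrow>
      (\<forall>i\<in>{1..n}. \<forall>k. \<forall>\<omega>\<in>space M. real (d i k \<omega>) \<le> \<tau>) \<longrightarrow>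
      (\<forall>\<omega>\<in>space M.
         afp_scheme s (t_par s \<tau>) (\<lambda>k. \<gamma>) (eta_par s \<tau> \<eta>) y0
           (delayed_estimator n Gs (\<lambda>i k. d i k \<omega>) (\<lambda>k. y k \<omega>))
           (\<lambda>k. x k \<omega>) (\<lambda>k. y k \<omega>) (\<lambda>k. z k \<omega>)) \<longrightarrow>
      xs \<in> zer G \<longrightarrow>
      ((\<forall>k. integrable M (\<lambda>\<omega>. (norm (G (y k \<omega>)))\<^sup>2) \<and>
            (\<integral>\<omega>. (norm (G (y k \<omega>)))\<^sup>2 \<partial>M)
              \<le> 4 * R0_sq \<gamma> s \<tau> \<eta> G y0 xs / (\<eta> * (real k + 3 * s + \<tau> - 1)\<^sup>2)) \<and>
       (\<lambda>k. (real k + \<tau>)\<^sup>2 * (\<integral>\<omega>. (norm (G (y k \<omega>)))\<^sup>2 \<partial>M)) \<longlonglongrightarrow> 0)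
      \<and>
      ((AE \<omega> in M. summable (\<lambda>k. (real k + \<tau>) * (norm (G (y k \<omega>)))\<^sup>2)) \<and>
       (AE \<omega> in M. (\<lambda>k. (real k + \<tau>)\<^sup>2 * (norm (G (y k \<omega>)))\<^sup>2) \<longlonglongrightarrow> 0) \<and>
       (\<exists>xlim \<in> borel_measurable M.
          (\<forall>\<omega>\<in>space M. xlim \<omega> \<in> zer G) \<and>
          (AE \<omega> in M. (\<lambda>k. x k \<omega>) \<longlonglongrightarrow> xlim \<omega> \<and>
                      (\<lambda>k. y k \<omega>) \<longlonglongrightarrow> xlim \<omega> \<and>
                      (\<lambda>k. z k \<omega>) \<longlonglongrightarrow> xlim \<omega>)))
      \<and>
      (\<forall>\<epsilon>>0.
         let K = C \<gamma> s (\<eta> / eta_bar \<gamma> s \<tau> \<beta> \<beta>') (norm (G y0)) (norm (y0 - xs)) in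
         (0 < \<beta>' \<and> \<beta>' \<le> threshold \<gamma> s \<tau> \<beta> \<longrightarrow>
            (\<exists>k. real k \<le> K * (\<tau> / \<epsilon> + \<tau> / (\<beta>' * \<epsilon>)) \<and>
                 (\<forall>j\<ge>k. (\<integral>\<omega>. (norm (G (y j \<omega>)))\<^sup>2 \<partial>M) \<le> \<epsilon>\<^sup>2))) \<and>
         (\<beta>' \<ge> threshold \<gamma> s \<tau> \<beta> \<longrightarrow>
            (\<exists>k. real k \<le> K * (\<tau> / \<epsilon> + \<tau> / (\<beta> * \<epsilon>)) \<and>
                 (\<forall>j\<ge>k. (\<integral>\<omega>. (norm (G (y j \<omega>)))\<^sup>2 \<partial>M) \<le> \<epsilon>\<^sup>2))))"
proof (intro exI allI impI)
  fix M :: "'w measure" and n :: nat and Gs :: "nat \<Rightarrow> real ^ 'p \<Rightarrow> real ^ 'p" and G :: "real ^ 'p \<Rightarrow> real ^ 'p"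
    and \<beta> \<beta>' \<gamma> s \<tau> \<eta> :: real and d :: "nat \<Rightarrow> nat \<Rightarrow> 'w \<Rightarrow> nat" and y0 xs :: "real ^ 'p"
    and x y z :: "nat \<Rightarrow> 'w \<Rightarrow> real ^ 'p"
  assume M: "prob_space M" and n: "1 \<le> n" and fsf: "finite_sum_form n Gs G"
    and "zer G \<noteq> {}" and \<beta>: "0 \<le> \<beta>" and "0 \<le> \<beta>'" and coco: "finite_sum_cocoercive \<beta> \<beta>' n Gs G"
    and \<gamma>: "0 < \<gamma>" "\<gamma> \<le> 1" and s: "1 + 3 * \<gamma> \<le> s" and \<tau>: "1 \<le> \<tau>"
    and \<eta>: "0 < \<eta>" "\<eta> \<le> eta_bar \<gamma> s \<tau> \<beta> \<beta>'"
    and d: "\<forall>i\<in>{1..n}. \<forall>k. d i k \<in> measurable M (count_space UNIV)"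
    and delays: "\<forall>i\<in>{1..n}. \<forall>k. \<forall>\<omega>\<in>space M. real (d i k \<omega>) \<le> \<tau>"
    and scheme: "\<forall>\<omega>\<in>space M. afp_scheme s (t_par s \<tau>) (\<lambda>k. \<gamma>) (eta_par s \<tau> \<eta>) y0
           (delayed_estimator n Gs (\<lambda>i k. d i k \<omega>) (\<lambda>k. y k \<omega>))
           (\<lambda>k. x k \<omega>) (\<lambda>k. y k \<omega>) (\<lambda>k. z k \<omega>)"
    and xs: "xs \<in> zer G"
  interpret prob_space M by (rule M)
  interpret afp_params \<gamma> s \<tau> \<eta> \<beta> \<beta>'
    using \<gamma> s \<tau> \<eta>(1) step_size_conditions[OF \<gamma> s \<tau> \<beta> \<eta>] by unfold_locales
  interpret afp_random \<gamma> s \<tau> \<eta> \<beta> \<beta>' M n Gs G d y0 xs x y z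
  proof (intro afp_random.intro afp_random_axioms.intro afp_params_axioms prob_space_axioms)
    fix \<omega> assume \<omega>: "\<omega> \<in> space M"
    show "afp_path \<gamma> s \<tau> \<eta> \<beta> \<beta>' n Gs G (\<lambda>i k. d i k \<omega>) y0 (\<lambda>k. x k \<omega>) (\<lambda>k. y k \<omega>) (\<lambda>k. z k \<omega>)"
      using n fsf coco delays scheme \<omega>
      by (intro afp_path.intro afp_path_axioms.intro afp_params_axioms) auto
  qed (use d xs in auto)
  let ?\<eta>0 = "eta_bar \<gamma> s \<tau> \<beta> \<beta>'"
  have \<eta>0: "0 < ?\<eta>0" using \<eta> by simp
  have count: "\<exists>k. real k \<le> (6 * s * norm (G y0) + 40 * s ^ 3 * norm (y0 - xs) / (\<gamma> * (\<eta> / ?\<eta>0))) * (\<tau> / \<epsilon> + \<tau> / (b * \<epsilon>))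
      \<and> (\<forall>j\<ge>k. (\<integral>\<omega>. (norm (G (y j \<omega>)))\<^sup>2 \<partial>M) \<le> \<epsilon>\<^sup>2)"
    if "0 < \<epsilon>" "0 < b" "b \<le> 5 * s * \<tau> * ?\<eta>0" for \<epsilon> b
    using that \<eta>0 expectation_bound by (intro iteration_count) (auto simp: R0_sq_def)
  \<comment> \<open>In the first regime \<beta>' equals
    \<open>7 / 3 * (1 + s - \<gamma>) * \<tau>\<close> times the maximal step size, in the second
    \<beta> equals \<open>1 + \<tau>\<close> times it; \<open>5 * s * \<tau>\<close> covers both
    factors.\<close>
  have b1: "\<beta>' \<le> 5 * s * \<tau> * ?\<eta>0" if "0 < \<beta>' \<and> \<beta>' \<le> threshold \<gamma> s \<tau> \<beta>"
  proof -
    have "7 * (1 + s - \<gamma>) * \<tau> \<le> 5 * s * \<tau> * 3" using s_gt \<gamma>_pos \<tau> by simp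
    then have "\<beta>' * (7 * (1 + s - \<gamma>) * \<tau>) \<le> \<beta>' * (5 * s * \<tau> * 3)"
      using that by (intro mult_left_mono) auto
    then have "\<beta>' \<le> \<beta>' * (5 * s * \<tau> * 3) / (7 * (1 + s - \<gamma>) * \<tau>)"
      using s_gt \<gamma> \<tau> by (subst pos_le_divide_eq) auto
    then show ?thesis using that by (simp add: eta_bar_def mult_ac)
  qed
  have b2: "\<beta> \<le> 5 * s * \<tau> * ?\<eta>0" if "threshold \<gamma> s \<tau> \<beta> \<le> \<beta>'"
  proof -
    have "1 + \<tau> \<le> 5 * \<tau>" using \<tau> by simp
    also have "\<dots> \<le> 5 * s * \<tau>" using s_gt \<tau> by simp
    finally have "\<beta> * (1 + \<tau>) \<le> \<beta> * (5 * s * \<tau>)" using \<beta> by (intro mult_left_mono)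
    then have "\<beta> \<le> \<beta> * (5 * s * \<tau>) / (1 + \<tau>)" using \<tau> by (subst pos_le_divide_eq) auto
    then show ?thesis
      using eta_bar_above_threshold[OF _ \<gamma>(2) \<tau> that] s_gt by (simp add: mult_ac)
  qed
  obtain xlim where xlim: "xlim \<in> borel_measurable M"
    "\<And>\<omega>. \<omega> \<in> space M \<Longrightarrow> xlim \<omega> \<in> zer G \<and> (\<lambda>k. x k \<omega>) \<longlonglongrightarrow> xlim \<omega>
       \<and> (\<lambda>k. y k \<omega>) \<longlonglongrightarrow> xlim \<omega> \<and> (\<lambda>k. z k \<omega>) \<longlonglongrightarrow> xlim \<omega>"
    using random_limit by blast
  have limits: "\<exists>xlim \<in> borel_measurable M. (\<forall>\<omega>\<in>space M. xlim \<omega> \<in> zer G) \<and>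
          (AE \<omega> in M. (\<lambda>k. x k \<omega>) \<longlonglongrightarrow> xlim \<omega> \<and> (\<lambda>k. y k \<omega>) \<longlonglongrightarrow> xlim \<omega> \<and> (\<lambda>k. z k \<omega>) \<longlonglongrightarrow> xlim \<omega>)"
    using xlim by (intro bexI[of _ xlim] conjI ballI AE_I2) auto
  show "((\<forall>k. integrable M (\<lambda>\<omega>. (norm (G (y k \<omega>)))\<^sup>2) \<and>
            (\<integral>\<omega>. (norm (G (y k \<omega>)))\<^sup>2 \<partial>M)
              \<le> 4 * R0_sq \<gamma> s \<tau> \<eta> G y0 xs / (\<eta> * (real k + 3 * s + \<tau> - 1)\<^sup>2)) \<and>
       (\<lambda>k. (real k + \<tau>)\<^sup>2 * (\<integral>\<omega>. (norm (G (y k \<omega>)))\<^sup>2 \<partial>M)) \<longlonglongrightarrow> 0)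
      \<and>
      ((AE \<omega> in M. summable (\<lambda>k. (real k + \<tau>) * (norm (G (y k \<omega>)))\<^sup>2)) \<and>
       (AE \<omega> in M. (\<lambda>k. (real k + \<tau>)\<^sup>2 * (norm (G (y k \<omega>)))\<^sup>2) \<longlonglongrightarrow> 0) \<and>
       (\<exists>xlim \<in> borel_measurable M.
          (\<forall>\<omega>\<in>space M. xlim \<omega> \<in> zer G) \<and>
          (AE \<omega> in M. (\<lambda>k. x k \<omega>) \<longlonglongrightarrow> xlim \<omega> \<and>
                      (\<lambda>k. y k \<omega>) \<longlonglongrightarrow> xlim \<omega> \<and>
                      (\<lambda>k. z k \<omega>) \<longlonglongrightarrow> xlim \<omega>)))
      \<and>
      (\<forall>\<epsilon>>0.
         let K = (\<lambda>\<gamma> s \<rho> a D. 6 * s * a + 40 * s ^ 3 * D / (\<gamma> * \<rho>)) \<gamma> s (\<eta> / ?\<eta>0) (norm (G y0)) (norm (y0 - xs)) in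
         (0 < \<beta>' \<and> \<beta>' \<le> threshold \<gamma> s \<tau> \<beta> \<longrightarrow>
            (\<exists>k. real k \<le> K * (\<tau> / \<epsilon> + \<tau> / (\<beta>' * \<epsilon>)) \<and>
                 (\<forall>j\<ge>k. (\<integral>\<omega>. (norm (G (y j \<omega>)))\<^sup>2 \<partial>M) \<le> \<epsilon>\<^sup>2))) \<and>
         (\<beta>' \<ge> threshold \<gamma> s \<tau> \<beta> \<longrightarrow>
            (\<exists>k. real k \<le> K * (\<tau> / \<epsilon> + \<tau> / (\<beta> * \<epsilon>)) \<and>
                 (\<forall>j\<ge>k. (\<integral>\<omega>. (norm (G (y j \<omega>)))\<^sup>2 \<partial>M) \<le> \<epsilon>\<^sup>2))))"
    unfolding Let_def
  proof (intro conjI allI impI)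
    fix k
    show "integrable M (\<lambda>\<omega>. (norm (G (y k \<omega>)))\<^sup>2)" by (rule residual_integrable)
    show "(\<integral>\<omega>. (norm (G (y k \<omega>)))\<^sup>2 \<partial>M) \<le> 4 * R / (\<eta> * (real k + 3 * s + \<tau> - 1)\<^sup>2)"
      by (rule expectation_bound)
  next
    fix \<epsilon> :: real
    assume \<epsilon>: "0 < \<epsilon>"
    show "\<exists>k. real k \<le> (6 * s * norm (G y0) + 40 * s ^ 3 * norm (y0 - xs) / (\<gamma> * (\<eta> / ?\<eta>0))) * (\<tau> / \<epsilon> + \<tau> / (\<beta>' * \<epsilon>)) \<and>
        (\<forall>j\<ge>k. (\<integral>\<omega>. (norm (G (y j \<omega>)))\<^sup>2 \<partial>M) \<le> \<epsilon>\<^sup>2)" if "0 < \<beta>' \<and> \<beta>' \<le> threshold \<gamma> s \<tau> \<beta>"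
      using \<epsilon> \<beta>'_pos b1[OF that] by (rule count)
    show "\<exists>k. real k \<le> (6 * s * norm (G y0) + 40 * s ^ 3 * norm (y0 - xs) / (\<gamma> * (\<eta> / ?\<eta>0))) * (\<tau> / \<epsilon> + \<tau> / (\<beta> * \<epsilon>)) \<and>
        (\<forall>j\<ge>k. (\<integral>\<omega>. (norm (G (y j \<omega>)))\<^sup>2 \<partial>M) \<le> \<epsilon>\<^sup>2)" if "\<beta>' \<ge> threshold \<gamma> s \<tau> \<beta>"
      using \<epsilon> \<beta>_pos b2[OF that] by (rule count)
  qed (use expectation_limit path_summable path_limit limits in auto)
qed

end
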